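(* Let $\mathcal A$ be a $\mathbb D$-normed bicomplex $C^*$-algebra and let $\mathcal I$ be a proper closed (two-sided) ideal of $\mathcal A$. Then the quotient $\mathcal A/\mathcal I$, with its quotient algebra structure, the $\mathbb D$-valued quotient norm and the involution $(x+\mathcal I)^*=x^*+\mathcal I$, is a $\mathbb D$-normed bicomplex $C^*$-algebra.
   Context: Bicomplex numbers: $\mathbb{BC}=\{z+jw : z,w\in\mathbb C(i)\}$, a commutative ring with $i^2=j^2=-1$, $ij=ji$; $\mathbb C(i)$ is the complex field with imaginary unit $i$. Put $e_1=\frac{1+ij}{2}$, $e_2=\frac{1-ij}{2}$; these are idempotents with $e_1e_2=0$, $e_1+e_2=1$, and every $Z=z+jw$ is uniquely $Z=e_1z_1+e_2z_2$ with $z_1=z-iw$, $z_2=z+iw\in\mathbb C(i)$. The conjugation $\dagger_3$ is $Z^{\dagger_3}=\bar z-j\bar w=e_1\overline{z_1}+e_2\overline{z_2}$. Hyperbolic numbers: $\mathbb D=\{e_1\alpha_1+e_2\alpha_2:\alpha_1,\alpha_2\in\mathbb R\}$, $\mathbb D^+=\{e_1\alpha_1+e_2\alpha_2:\alpha_1,\alpha_2\ge 0\}$, and $\alpha\leq'\beta$ means $\beta-\alpha\in\mathbb D^+$; infima in $\mathbb D$ are with respect to $\leq'$ (i.e. componentwise in $\alpha_1,\alpha_2$). The hyperbolic modulus is $|Z|_k=e_1|z_1|+e_2|z_2|\in\mathbb D^+$. A bicomplex algebra $\mathcal A$ is a $\mathbb{BC}$-module with an associative, distributive multiplication satisfying $\lambda(xy)=(\lambda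 x)y=x(\lambda y)$ for $\lambda\in\mathbb{BC}$. A $\mathbb D$-valued norm is a map $\|\cdot\|_{\mathbb D}:\mathcal A\to\mathbb D^+$ with $\|x\|_{\mathbb D}=0$ iff $x=0$, $\|\lambda x\|_{\mathbb D}=|\lambda|_k\|x\|_{\mathbb D}$ and $\|x+y\|_{\mathbb D}\leq'\|x\|_{\mathbb D}+\|y\|_{\mathbb D}$. An involution on $\mathcal A$ is a map $x\mapsto x^*$ with $(x^* )^*=x$, $(xy)^*=y^*x^*$, $(\lambda x+y)^*=\lambda^{\dagger_3}x^*+y^*$ for $\lambda\in\mathbb{BC}$. $\mathcal A$ is a $\mathbb D$-normed bicomplex Banach algebra if it is complete with respect to $\|\cdot\|_{\mathbb D}$ and $\|xy\|_{\mathbb D}\leq'\|x\|_{\mathbb D}\|y\|_{\mathbb D}$ for all $x,y$. It is a $\mathbb D$-normed bicomplex $C^*$-algebra if in addition it has an involution with $\|x^*x\|_{\mathbb D}=\|x\|_{\mathbb D}^2$ for all $x$. Algebras are not assumed unital. A (two-sided) ideal $\mathcal I$ of $\mathcal A$ is a subalgebra (in particular a $\mathbb{BC}$-submodule) with $xy,yx\in\mathcal I$ whenever $x\in\mathcal A$, $y\in\mathcal I$; it is proper if $\mathcal I\ne\mathcal A$. On $\mathcal A/\mathcal I=\{x+\mathcal I: x\in\mathcal A\}$ the multiplication is $(x+\mathcal I)(y+\mathcal I)=xy+\mathcal I$, the quotient norm is $\|x+\mathcal I\|_{\mathbb D}=\inf\{\|x-y\|_{\mathbb D}: y\in\mathcal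 I\}$, and the involution is $(x+\mathcal I)^*=x^*+\mathcal I$ (that this is well defined, i.e. that $\mathcal I$ is self-adjoint, is part of the assertion). *)

theory Defs
  imports Complex_Main "HOL-Algebra.Algebraic_Closure_Type"
begin

section \<open>Bicomplex numbers\<close>

text \<open>\<open>Bicomplex z w\<close> stands for \<open>z + j w\<close>.\<close>

datatype bicomplex = Bicomplex (bc_fst: complex) (bc_snd: complex)

lemma bicomplex_eqI: "bc_fst x = bc_fst y \<Longrightarrow> bc_snd x = bc_snd y \<Longrightarrow> x = y"
  by (cases x; cases y) simp

instantiation bicomplex :: comm_ring_1
begin

definition zero_bicomplex :: bicomplex where "0 = Bicomplex 0 0"
definition one_bicomplex :: bicomplex where "1 = Bicomplex 1 0"
definition plus_bicomplex :: "bicomplex \<Rightarrow> bicomplex \<Rightarrow> bicomplex" where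
  "x + y = Bicomplex (bc_fst x + bc_fst y) (bc_snd x + bc_snd y)"
definition uminus_bicomplex :: "bicomplex \<Rightarrow> bicomplex" where
  "- x = Bicomplex (- bc_fst x) (- bc_snd x)"
definition minus_bicomplex :: "bicomplex \<Rightarrow> bicomplex \<Rightarrow> bicomplex" where
  "x - y = Bicomplex (bc_fst x - bc_fst y) (bc_snd x - bc_snd y)"
definition times_bicomplex :: "bicomplex \<Rightarrow> bicomplex \<Rightarrow> bicomplex" where
  "x * y = Bicomplex (bc_fst x * bc_fst y - bc_snd x * bc_snd y)
                     (bc_fst x * bc_snd y + bc_snd x * bc_fst y)"

instance
  by standard
    (auto simp: zero_bicomplex_def one_bicomplex_def plus_bicomplex_def uminus_bicomplex_def
        minus_bicomplex_def times_bicomplex_def algebra_simps intro!: bicomplex_eqI)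

end

instantiation bicomplex :: real_algebra_1
begin

definition scaleR_bicomplex :: "real \<Rightarrow> bicomplex \<Rightarrow> bicomplex" where
  "scaleR r x = Bicomplex (scaleR r (bc_fst x)) (scaleR r (bc_snd x))"

instance
  by standard
    (auto simp: scaleR_bicomplex_def plus_bicomplex_def times_bicomplex_def algebra_simps
        intro!: bicomplex_eqI)

end

lemmas bicomplex_defs = zero_bicomplex_def one_bicomplex_def plus_bicomplex_def
  uminus_bicomplex_def minus_bicomplex_def times_bicomplex_def scaleR_bicomplex_def

definition bc_of_complex :: "complex \<Rightarrow> bicomplex" where
  "bc_of_complex z = Bicomplex z 0"

definition bc_i :: bicomplex where "bc_i = bc_of_complex \<i>"
definition bc_j :: bicomplex where "bc_j = Bicomplex 0 1"

lemma bicomplex_eq: "Bicomplex z w = bc_of_complex z + bc_j * bc_of_complex w"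
  by (simp add: bc_of_complex_def bc_j_def bicomplex_defs)

definition bc_e1 :: bicomplex where "bc_e1 = (1 / 2) *\<^sub>R (1 + bc_i * bc_j)"
definition bc_e2 :: bicomplex where "bc_e2 = (1 / 2) *\<^sub>R (1 - bc_i * bc_j)"

text \<open>The idempotent components of \<open>Z = z + j w\<close>.\<close>

definition bc_comp1 :: "bicomplex \<Rightarrow> complex" where
  "bc_comp1 Z = bc_fst Z - \<i> * bc_snd Z"
definition bc_comp2 :: "bicomplex \<Rightarrow> complex" where
  "bc_comp2 Z = bc_fst Z + \<i> * bc_snd Z"

lemma bc_idempotent_decomposition:
  "Z = bc_e1 * bc_of_complex (bc_comp1 Z) + bc_e2 * bc_of_complex (bc_comp2 Z)"
  by (cases Z)
    (simp add: bc_e1_def bc_e2_def bc_i_def bc_j_def bc_of_complex_def bc_comp1_def bc_comp2_def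
       bicomplex_defs complex_eq_iff field_simps)

definition bc_dagger3 :: "bicomplex \<Rightarrow> bicomplex" where
  "bc_dagger3 Z = Bicomplex (cnj (bc_fst Z)) (- cnj (bc_snd Z))"


section \<open>Hyperbolic numbers\<close>

definition hyp :: "real \<Rightarrow> real \<Rightarrow> bicomplex" where
  "hyp a b = bc_e1 * of_real a + bc_e2 * of_real b"

definition hyperbolic :: "bicomplex set" where
  "hyperbolic = {hyp a b | a b. True}"

definition hyp_nonneg :: "bicomplex set" where
  "hyp_nonneg = {hyp a b | a b. 0 \<le> a \<and> 0 \<le> b}"

text \<open>Both components are strictly positive, so no zero divisors occur here.\<close>

definition hyp_pos :: "bicomplex set" where
  "hyp_pos = {hyp a b | a b. 0 < a \<and> 0 < b}"

definition hyp_le :: "bicomplex \<Rightarrow> bicomplex \<Rightarrow> bool" (infix \<open>\<le>\<^sub>D\<close> 50) where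
  "\<alpha> \<le>\<^sub>D \<beta> \<longleftrightarrow> \<beta> - \<alpha> \<in> hyp_nonneg"

definition hyp_Inf :: "bicomplex set \<Rightarrow> bicomplex" where
  "hyp_Inf S = (THE m. m \<in> hyperbolic \<and> (\<forall>s\<in>S. m \<le>\<^sub>D s) \<and>
     (\<forall>b\<in>hyperbolic. (\<forall>s\<in>S. b \<le>\<^sub>D s) \<longrightarrow> b \<le>\<^sub>D m))"

definition hyp_modulus :: "bicomplex \<Rightarrow> bicomplex" where
  "hyp_modulus Z = hyp (cmod (bc_comp1 Z)) (cmod (bc_comp2 Z))"

lemma hyp_eq_iff [simp]: "hyp a b = hyp c d \<longleftrightarrow> a = c \<and> b = d"
  by (auto simp: hyp_def of_real_def bc_e1_def bc_e2_def bc_i_def bc_j_def bc_of_complex_def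
      bicomplex_defs complex_eq_iff field_simps)

lemma hyp_diff: "hyp a b - hyp c d = hyp (a - c) (b - d)"
  by (simp add: hyp_def algebra_simps)

lemma hyp_le_iff [simp]: "hyp a b \<le>\<^sub>D hyp c d \<longleftrightarrow> a \<le> c \<and> b \<le> d"
  by (auto simp: hyp_le_def hyp_nonneg_def hyp_diff)

lemma hyp_Inf_componentwise:
  assumes "P \<noteq> {}" "bdd_below (fst ` P)" "bdd_below (snd ` P)"
  shows "hyp_Inf (case_prod hyp ` P) = hyp (Inf (fst ` P)) (Inf (snd ` P))"
    (is "_ = hyp ?a ?b")
  unfolding hyp_Inf_def
proof (rule the_equality)
  have lower: "\<forall>s\<in>case_prod hyp ` P. hyp ?a ?b \<le>\<^sub>D s"
    using assms by (force intro: cInf_lower)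
  have greatest: "b \<le>\<^sub>D hyp ?a ?b"
    if "b \<in> hyperbolic" "\<forall>s\<in>case_prod hyp ` P. b \<le>\<^sub>D s" for b
    using that assms by (fastforce simp: hyperbolic_def intro!: cInf_greatest)
  show "hyp ?a ?b \<in> hyperbolic \<and> (\<forall>s\<in>case_prod hyp ` P. hyp ?a ?b \<le>\<^sub>D s) \<and>
     (\<forall>b\<in>hyperbolic. (\<forall>s\<in>case_prod hyp ` P. b \<le>\<^sub>D s) \<longrightarrow> b \<le>\<^sub>D hyp ?a ?b)"
    using lower greatest by (auto simp: hyperbolic_def)
  fix m
  assume m: "m \<in> hyperbolic \<and> (\<forall>s\<in>case_prod hyp ` P. m \<le>\<^sub>D s) \<and>
     (\<forall>b\<in>hyperbolic. (\<forall>s\<in>case_prod hyp ` P. b \<le>\<^sub>D s) \<longrightarrow> b \<le>\<^sub>D m)"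
  then have "m \<le>\<^sub>D hyp ?a ?b" "hyp ?a ?b \<le>\<^sub>D m"
    using lower greatest by (auto simp: hyperbolic_def)
  with m show "m = hyp ?a ?b"
    by (auto simp: hyperbolic_def)
qed


section \<open>Bicomplex C*-algebras\<close>

text \<open>
  The record inherits the field \<open>one\<close> from HOL-Algebra's \<open>module\<close>.  It is never constrained
  below and carries no meaning: the algebras are not assumed to be unital.
\<close>

record 'a bc_star_algebra = "(bicomplex, 'a) module" +
  dnorm :: "'a \<Rightarrow> bicomplex"
  star :: "'a \<Rightarrow> 'a"

abbreviation BC :: "bicomplex ring" where
  "BC \<equiv> ring_of_type_algebra"

locale bc_algebra = module BC A for A :: "'a bc_star_algebra" (structure) +
  assumes mult_closed: "\<lbrakk>x \<in> carrier A; y \<in> carrier A\<rbrakk> \<Longrightarrow> x \<otimes> y \<in> carrier A"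
    and mult_assoc: "\<lbrakk>x \<in> carrier A; y \<in> carrier A; z \<in> carrier A\<rbrakk> \<Longrightarrow>
      (x \<otimes> y) \<otimes> z = x \<otimes> (y \<otimes> z)"
    and distrib_right: "\<lbrakk>x \<in> carrier A; y \<in> carrier A; z \<in> carrier A\<rbrakk> \<Longrightarrow>
      (x \<oplus> y) \<otimes> z = x \<otimes> z \<oplus> y \<otimes> z"
    and distrib_left: "\<lbrakk>x \<in> carrier A; y \<in> carrier A; z \<in> carrier A\<rbrakk> \<Longrightarrow>
      z \<otimes> (x \<oplus> y) = z \<otimes> x \<oplus> z \<otimes> y"
    and smult_mult_left: "\<lbrakk>x \<in> carrier A; y \<in> carrier A\<rbrakk> \<Longrightarrow>
      c \<odot> (x \<otimes> y) = (c \<odot> x) \<otimes> y"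
    and smult_mult_right: "\<lbrakk>x \<in> carrier A; y \<in> carrier A\<rbrakk> \<Longrightarrow>
      c \<odot> (x \<otimes> y) = x \<otimes> (c \<odot> y)"

definition D_converges ::
  "'a bc_star_algebra \<Rightarrow> (nat \<Rightarrow> 'a) \<Rightarrow> 'a \<Rightarrow> bool" where
  "D_converges A u l \<longleftrightarrow>
     (\<forall>\<epsilon>\<in>hyp_pos. \<exists>N. \<forall>n\<ge>N. dnorm A (u n \<ominus>\<^bsub>A\<^esub> l) \<le>\<^sub>D \<epsilon>)"

definition D_Cauchy :: "'a bc_star_algebra \<Rightarrow> (nat \<Rightarrow> 'a) \<Rightarrow> bool" where
  "D_Cauchy A u \<longleftrightarrow>
     (\<forall>\<epsilon>\<in>hyp_pos. \<exists>N. \<forall>m\<ge>N. \<forall>n\<ge>N. dnorm A (u m \<ominus>\<^bsub>A\<^esub> u n) \<le>\<^sub>D \<epsilon>)"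

locale bc_banach_algebra = bc_algebra +
  assumes norm_nonneg: "x \<in> carrier A \<Longrightarrow> dnorm A x \<in> hyp_nonneg"
    and norm_eq_zero_iff: "x \<in> carrier A \<Longrightarrow> dnorm A x = 0 \<longleftrightarrow> x = \<zero>"
    and norm_smult: "x \<in> carrier A \<Longrightarrow> dnorm A (c \<odot> x) = hyp_modulus c * dnorm A x"
    and norm_triangle: "\<lbrakk>x \<in> carrier A; y \<in> carrier A\<rbrakk> \<Longrightarrow>
      dnorm A (x \<oplus> y) \<le>\<^sub>D dnorm A x + dnorm A y"
    and norm_mult: "\<lbrakk>x \<in> carrier A; y \<in> carrier A\<rbrakk> \<Longrightarrow>
      dnorm A (x \<otimes> y) \<le>\<^sub>D dnorm A x * dnorm A y"
    and complete: "\<lbrakk>range u \<subseteq> carrier A; D_Cauchy A u\<rbrakk> \<Longrightarrow>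
      \<exists>l\<in>carrier A. D_converges A u l"

locale bc_cstar_algebra = bc_banach_algebra +
  assumes star_closed: "x \<in> carrier A \<Longrightarrow> star A x \<in> carrier A"
    and star_star: "x \<in> carrier A \<Longrightarrow> star A (star A x) = x"
    and star_mult: "\<lbrakk>x \<in> carrier A; y \<in> carrier A\<rbrakk> \<Longrightarrow>
      star A (x \<otimes> y) = star A y \<otimes> star A x"
    and star_conj_linear: "\<lbrakk>x \<in> carrier A; y \<in> carrier A\<rbrakk> \<Longrightarrow>
      star A (c \<odot> x \<oplus> y) = bc_dagger3 c \<odot> star A x \<oplus> star A y"
    and norm_star_mult: "x \<in> carrier A \<Longrightarrow> dnorm A (star A x \<otimes> x) = (dnorm A x)\<^sup>2"


section \<open>Ideals and quotients\<close>

locale bc_ideal = submodule I BC A for I and A :: "'a bc_star_algebra" (structure) +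
  assumes ideal_left: "\<lbrakk>x \<in> carrier A; y \<in> I\<rbrakk> \<Longrightarrow> x \<otimes> y \<in> I"
    and ideal_right: "\<lbrakk>x \<in> carrier A; y \<in> I\<rbrakk> \<Longrightarrow> y \<otimes> x \<in> I"

definition D_closed :: "'a bc_star_algebra \<Rightarrow> 'a set \<Rightarrow> bool" where
  "D_closed A S \<longleftrightarrow>
     (\<forall>u l. range u \<subseteq> S \<and> l \<in> carrier A \<and> D_converges A u l \<longrightarrow> l \<in> S)"

text \<open>
  As in \<open>FactRing\<close> of HOL-Algebra, each operation on cosets is the union of the results over all
  representatives; this is a single coset exactly when the operation is well defined.  The norm is
  likewise an infimum over all representatives \<open>x\<close>; the lemma \<open>dnorm_bc_quotient\<close> below
  recovers the usual formula for any one of them.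
\<close>

definition bc_quotient :: "'a bc_star_algebra \<Rightarrow> 'a set \<Rightarrow> 'a set bc_star_algebra" where
  "bc_quotient A I =
     \<lparr>carrier = a_rcosets\<^bsub>A\<^esub> I, monoid.mult = rcoset_mult A I, one = I +>\<^bsub>A\<^esub> \<one>\<^bsub>A\<^esub>,
      zero = I, add = set_add A,
      module.smult = (\<lambda>c C. \<Union>x\<in>C. I +>\<^bsub>A\<^esub> (c \<odot>\<^bsub>A\<^esub> x)),
      dnorm = (\<lambda>C. hyp_Inf {dnorm A (x \<ominus>\<^bsub>A\<^esub> y) | x y. x \<in> C \<and> y \<in> I}),
      star = (\<lambda>C. \<Union>x\<in>C. I +>\<^bsub>A\<^esub> star A x)\<rparr>"

context
  fixes A :: "'a bc_star_algebra" (structure) and I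
  assumes alg: "bc_algebra A" and ideal: "bc_ideal I A"
begin

interpretation bc_algebra A by (rule alg)
interpretation bc_ideal I A by (rule ideal)

lemma ideal_subset: "I \<subseteq> carrier A"
  using subset by simp

lemma ideal_abelian_subgroup: "abelian_subgroup I A"
  by (intro abelian_subgroupI3 additive_subgroup.intro M.abelian_group_axioms)
    (rule submodule.axioms(1)[OF bc_ideal.axioms(1)[OF ideal]])

interpretation abelian_subgroup I A by (rule ideal_abelian_subgroup)

lemma mem_cosetD: "x' \<in> I +> x \<Longrightarrow> \<exists>h\<in>I. x' = h \<oplus> x"
  by (auto simp: a_r_coset_def')

lemma coset_absorb: "h \<in> I \<Longrightarrow> x \<in> carrier A \<Longrightarrow> I +> (h \<oplus> x) = I +> x"
  by (metis a_repr_independence a_rcosI a_subset a_subgroup)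

lemma add_bc_quotient:
  "x \<in> carrier A \<Longrightarrow> y \<in> carrier A \<Longrightarrow>
    (I +> x) \<oplus>\<^bsub>bc_quotient A I\<^esub> (I +> y) = I +> (x \<oplus> y)"
  by (simp add: bc_quotient_def a_rcos_sum)

lemma mult_bc_quotient:
  assumes "x \<in> carrier A" "y \<in> carrier A"
  shows "(I +> x) \<otimes>\<^bsub>bc_quotient A I\<^esub> (I +> y) = I +> (x \<otimes> y)"
proof -
  have eq: "I +> (x' \<otimes> y') = I +> (x \<otimes> y)" if x': "x' \<in> I +> x" and y': "y' \<in> I +> y" for x' y'
  proof -
    obtain h k where hk: "h \<in> I" "x' = h \<oplus> x" "k \<in> I" "y' = k \<oplus> y"
      using mem_cosetD[OF x'] mem_cosetD[OF y'] by blast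
    then have car: "h \<in> carrier A" "k \<in> carrier A"
      using ideal_subset by auto
    have "x' \<otimes> y' = (h \<otimes> (k \<oplus> y) \<oplus> x \<otimes> k) \<oplus> x \<otimes> y"
      using hk car assms by (simp add: distrib_left distrib_right mult_closed M.a_assoc M.a_lcomm)
    moreover have "h \<otimes> (k \<oplus> y) \<oplus> x \<otimes> k \<in> I"
      using hk car assms by (intro a_closed ideal_left ideal_right) auto
    ultimately show ?thesis
      using assms by (simp add: coset_absorb mult_closed)
  qed
  have "(I +> x) \<otimes>\<^bsub>bc_quotient A I\<^esub> (I +> y) = (\<Union>a\<in>I +> x. \<Union>b\<in>I +> y. I +> (a \<otimes> b))"
    by (simp add: bc_quotient_def rcoset_mult_def)
  also have "\<dots> = (\<Union>a\<in>I +> x. \<Union>b\<in>I +> y. I +> (x \<otimes> y))"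
    by (intro SUP_cong refl eq)
  also have "\<dots> = I +> (x \<otimes> y)"
    using assms[THEN a_rcos_self] by auto
  finally show ?thesis .
qed

lemma smult_bc_quotient:
  assumes "x \<in> carrier A"
  shows "c \<odot>\<^bsub>bc_quotient A I\<^esub> (I +> x) = I +> (c \<odot> x)"
proof -
  have eq: "I +> (c \<odot> x') = I +> (c \<odot> x)" if x': "x' \<in> I +> x" for x'
  proof -
    obtain h where h: "h \<in> I" "x' = h \<oplus> x"
      using mem_cosetD[OF x'] by blast
    then have "c \<odot> x' = c \<odot> h \<oplus> c \<odot> x"
      using assms ideal_subset by (auto simp: smult_r_distr ring_of_type_algebra_def)
    moreover have "c \<odot> h \<in> I" "c \<odot> x \<in> carrier A"
      using h assms by (auto simp: ring_of_type_algebra_def)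
    ultimately show ?thesis
      using coset_absorb by simp
  qed
  have "c \<odot>\<^bsub>bc_quotient A I\<^esub> (I +> x) = (\<Union>a\<in>I +> x. I +> (c \<odot> a))"
    by (simp add: bc_quotient_def)
  also have "\<dots> = (\<Union>a\<in>I +> x. I +> (c \<odot> x))"
    by (intro SUP_cong refl eq)
  also have "\<dots> = I +> (c \<odot> x)"
    using assms[THEN a_rcos_self] by auto
  finally show ?thesis .
qed

lemma dnorm_bc_quotient:
  assumes "x \<in> carrier A"
  shows "dnorm (bc_quotient A I) (I +> x) = hyp_Inf {dnorm A (x \<ominus> y) | y. y \<in> I}"
proof -
  have repr: "\<exists>z\<in>I. x' \<ominus> y = x \<ominus> z" if x': "x' \<in> I +> x" and y: "y \<in> I" for x' y
  proof -
    obtain h where h: "h \<in> I" "x' = h \<oplus> x"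
      using mem_cosetD[OF x'] by blast
    have "h \<in> carrier A" "y \<in> carrier A"
      using h y ideal_subset by auto
    then have "x' \<ominus> y = x \<ominus> (y \<ominus> h)"
      using h(2) assms by (simp add: a_minus_def M.minus_add M.a_ac)
    moreover have "y \<ominus> h \<in> I"
      using h y unfolding a_minus_def by simp
    ultimately show ?thesis by blast
  qed
  have "{dnorm A (x' \<ominus> y) | x' y. x' \<in> I +> x \<and> y \<in> I} = {dnorm A (x \<ominus> y) | y. y \<in> I}"
  proof (intro equalityI subsetI)
    fix r assume "r \<in> {dnorm A (x' \<ominus> y) | x' y. x' \<in> I +> x \<and> y \<in> I}"
    then obtain x' y where "r = dnorm A (x' \<ominus> y)" "x' \<in> I +> x" "y \<in> I" by blast
    with repr[of x' y] show "r \<in> {dnorm A (x \<ominus> y) | y. y \<in> I}" by auto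
  next
    fix r assume "r \<in> {dnorm A (x \<ominus> y) | y. y \<in> I}"
    with assms[THEN a_rcos_self] show "r \<in> {dnorm A (x' \<ominus> y) | x' y. x' \<in> I +> x \<and> y \<in> I}"
      by blast
  qed
  then show ?thesis
    by (simp add: bc_quotient_def)
qed

end

end

(* Each idempotent component of the hyperbolic norm is a C*-seminorm n. The usual approximate unit
   needs positivity and functional calculus; here it is replaced by an explicit polynomial. For y in
   I and h = y* y put V = 1 + i \<epsilon> h. The C*-identity for h = h* gives
   n (x V)^2 \<le> (1 + \<epsilon>^2 n(h)^2) n(x)^2, so the average r = (1/m) (1 + V + ... + V^(m-1)) satisfies
   n (x r) \<le> K n(x) with K = exp (m \<epsilon>^2 n(h)^2), while i \<epsilon> h r = (V^m - 1) / m forces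
   n (h r) \<le> (1 + K) / (\<epsilon> m). With \<epsilon> = 1/N^2 and m = N^3 we get K \<rightarrow> 1 and n (h r) \<rightarrow> 0, hence also
   n (y r) \<rightarrow> 0, and r = 1 - q with both q and q* in I. Therefore y* is the limit of q* y*, so I is
   self-adjoint, and n (x r)^2 \<le> K n (x* x r) yields the C*-identity of the quotient norm. *)

theory Submission
  imports Defs
begin

section \<open>Bicomplex scalars and component seminorms\<close>

lemma ring_of_type_algebra_simps [simp]:
  "carrier ring_of_type_algebra = UNIV"
  "x \<oplus>\<^bsub>ring_of_type_algebra\<^esub> y = x + y"
  "x \<otimes>\<^bsub>ring_of_type_algebra\<^esub> y = x * y"
  "\<one>\<^bsub>ring_of_type_algebra\<^esub> = 1"
  "\<zero>\<^bsub>ring_of_type_algebra\<^esub> = 0"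
  by (simp_all add: ring_of_type_algebra_def)

lemma bc_comp_simps [simp]:
  "bc_comp1 (x + y) = bc_comp1 x + bc_comp1 y"
  "bc_comp2 (x + y) = bc_comp2 x + bc_comp2 y"
  "bc_comp1 (x * y) = bc_comp1 x * bc_comp1 y"
  "bc_comp2 (x * y) = bc_comp2 x * bc_comp2 y"
  "bc_comp1 (bc_of_complex z) = z"
  "bc_comp2 (bc_of_complex z) = z"
  "bc_comp1 (hyp a b) = of_real a"
  "bc_comp2 (hyp a b) = of_real b"
  "bc_comp1 bc_e1 = 1"
  "bc_comp2 bc_e1 = 0"
  "bc_comp1 bc_e2 = 0"
  "bc_comp2 bc_e2 = 1"
  by (simp_all add: bc_comp1_def bc_comp2_def bicomplex_defs bc_of_complex_def hyp_def bc_e1_def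
      bc_e2_def bc_i_def bc_j_def of_real_def complex_eq_iff field_simps)

lemma bc_dagger3_of_complex [simp]: "bc_dagger3 (bc_of_complex z) = bc_of_complex (cnj z)"
  by (simp add: bc_dagger3_def bc_of_complex_def)

lemma bc_dagger3_one [simp]: "bc_dagger3 1 = 1"
  by (simp add: bc_dagger3_def bicomplex_defs)

lemma bc_dagger3_neg_one [simp]: "bc_dagger3 (- 1) = - 1"
  by (simp add: bc_dagger3_def bicomplex_defs)

lemma bc_of_complex_mult: "bc_of_complex z * bc_of_complex w = bc_of_complex (z * w)"
  and bc_of_complex_add: "bc_of_complex z + bc_of_complex w = bc_of_complex (z + w)"
  and bc_of_complex_one: "bc_of_complex 1 = 1"
  and bc_of_complex_zero: "bc_of_complex 0 = 0"
  and bc_of_complex_minus: "bc_of_complex (- z) = - bc_of_complex z"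
  by (simp_all add: bc_of_complex_def bicomplex_defs)

lemma bc_e1_plus_e2: "bc_e1 + bc_e2 = 1"
  by (simp add: bc_e1_def bc_e2_def bicomplex_defs bc_i_def bc_j_def bc_of_complex_def complex_eq_iff)

lemma hyp_add: "hyp a b + hyp c d = hyp (a + c) (b + d)"
  and hyp_mult: "hyp a b * hyp c d = hyp (a * c) (b * d)"
  and hyp_power2: "(hyp a b)\<^sup>2 = hyp (a\<^sup>2) (b\<^sup>2)"
  and hyp_zero: "0 = hyp 0 0"
  by (simp_all add: hyp_def bc_e1_def bc_e2_def bc_i_def bc_j_def bc_of_complex_def of_real_def
      bicomplex_defs complex_eq_iff field_simps power2_eq_square)

lemma hyp_in_nonneg_iff [simp]: "hyp a b \<in> hyp_nonneg \<longleftrightarrow> 0 \<le> a \<and> 0 \<le> b"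
  and hyp_in_pos_iff [simp]: "hyp a b \<in> hyp_pos \<longleftrightarrow> 0 < a \<and> 0 < b"
  by (auto simp: hyp_nonneg_def hyp_pos_def)

section \<open>Bilinear calculus in an algebra without unit\<close>

context bc_algebra
begin

declare mult_closed [simp]

lemma smult_closed' [simp]: "x \<in> carrier A \<Longrightarrow> c \<odot> x \<in> carrier A"
  by (rule smult_closed) simp

lemma smult_add_left: "x \<in> carrier A \<Longrightarrow> (c + d) \<odot> x = c \<odot> x \<oplus> d \<odot> x"
  using smult_l_distr[of c d x] by simp

lemma smult_add_right:
  "x \<in> carrier A \<Longrightarrow> y \<in> carrier A \<Longrightarrow> c \<odot> (x \<oplus> y) = c \<odot> x \<oplus> c \<odot> y"
  using smult_r_distr[of c x y] by simp

lemma smult_smult: "x \<in> carrier A \<Longrightarrow> c \<odot> (d \<odot> x) = (c * d) \<odot> x"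
  using smult_assoc1[of c d x] by simp

lemma smult_one' [simp]: "x \<in> carrier A \<Longrightarrow> 1 \<odot> x = x"
  using smult_one[of x] by simp

lemma smult_zero_left [simp]: "x \<in> carrier A \<Longrightarrow> 0 \<odot> x = \<zero>"
  using smult_l_null[of x] by simp

lemma smult_zero_right [simp]: "c \<odot> \<zero> = \<zero>"
  using smult_r_null[of c] by simp

lemma minus_eq_smult: "x \<in> carrier A \<Longrightarrow> \<ominus> x = (- 1) \<odot> x"
  by (rule M.minus_equality) (simp_all flip: smult_add_left[of x "- 1" 1, simplified])

lemma diff_eq: "x \<in> carrier A \<Longrightarrow> y \<in> carrier A \<Longrightarrow> x \<ominus> y = x \<oplus> (- 1) \<odot> y"
  by (simp add: a_minus_def minus_eq_smult)

lemma add_neg_smult [simp]: "x \<in> carrier A \<Longrightarrow> x \<oplus> (- 1) \<odot> x = \<zero>"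
  "x \<in> carrier A \<Longrightarrow> (- 1) \<odot> x \<oplus> x = \<zero>"
  by (simp_all add: M.r_neg M.l_neg flip: minus_eq_smult)

lemma add_neg_smult_left [simp]:
  assumes "x \<in> carrier A" "y \<in> carrier A"
  shows "x \<oplus> ((- 1) \<odot> x \<oplus> y) = y" "(- 1) \<odot> x \<oplus> (x \<oplus> y) = y"
  using assms by (simp_all flip: M.a_assoc)

lemma mult_zero_left [simp]: "x \<in> carrier A \<Longrightarrow> \<zero> \<otimes> x = \<zero>"
  using smult_mult_left[of \<zero> x 0] by simp

lemma mult_zero_right [simp]: "x \<in> carrier A \<Longrightarrow> x \<otimes> \<zero> = \<zero>"
  using smult_mult_right[of x \<zero> 0] by simp

text \<open>A normal form for bilinear expressions: subtraction is rewritten to multiplication by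
  \<open>- 1\<close> because \<open>\<ominus>\<close> has no distributivity rules over a multiplication without unit.\<close>

lemmas algebra_normalize = distrib_left distrib_right mult_assoc smult_mult_left[symmetric]
  smult_mult_right[symmetric] smult_add_right smult_smult diff_eq M.a_ac

end

text \<open>Captures what the two idempotent components of the norm share, so that each estimate is
  proved once and instantiated for \<open>norm1\<close> and \<open>norm2\<close>. The map
  \<open>\<phi>\<close> reads off the matching component of a scalar. Only a seminorm is available:
  a nonzero scalar c can have \<open>\<phi> c = 0\<close>, and then n vanishes on all multiples of
  c.\<close>

locale component_seminorm = bc_cstar_algebra A for A (structure) +
  fixes n :: "'a \<Rightarrow> real" and \<phi> :: "bicomplex \<Rightarrow> complex"
  assumes n_nonneg [simp]: "x \<in> carrier A \<Longrightarrow> 0 \<le> n x"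
    and n_add: "\<lbrakk>x \<in> carrier A; y \<in> carrier A\<rbrakk> \<Longrightarrow> n (x \<oplus> y) \<le> n x + n y"
    and n_mult: "\<lbrakk>x \<in> carrier A; y \<in> carrier A\<rbrakk> \<Longrightarrow> n (x \<otimes> y) \<le> n x * n y"
    and n_smult: "x \<in> carrier A \<Longrightarrow> n (c \<odot> x) = cmod (\<phi> c) * n x"
    and n_star_mult: "x \<in> carrier A \<Longrightarrow> n (star A x \<otimes> x) = (n x)\<^sup>2"
    and \<phi>_of_complex [simp]: "\<phi> (bc_of_complex z) = z"
    and \<phi>_mult: "\<phi> (c * d) = \<phi> c * \<phi> d"
    and \<phi>_add: "\<phi> (c + d) = \<phi> c + \<phi> d"

section \<open>The involution and the real components of the norm\<close>

context bc_cstar_algebra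
begin

declare star_closed [simp] star_star [simp]

text \<open>The axiom \<open>star_conj_linear\<close> couples scaling with addition; isolating
  scaling in \<open>star_smult\<close> takes \<zero> as second summand and so needs this value. It
  comes from evaluating the star of \<open>star A \<zero> \<oplus> \<zero>\<close> in two
  ways.\<close>

lemma star_zero [simp]: "star A \<zero> = \<zero>"
proof -
  have "\<zero> = star A (star A \<zero>)" by simp
  also have "\<dots> = star A (star A \<zero> \<oplus> \<zero>)" by (simp del: star_star)
  also have "\<dots> = star A (1 \<odot> star A \<zero> \<oplus> \<zero>)" by simp
  also have "\<dots> = \<zero> \<oplus> star A \<zero>"
    by (subst star_conj_linear) simp_all
  finally show ?thesis by simp
qed

lemma star_add: "x \<in> carrier A \<Longrightarrow> y \<in> carrier A \<Longrightarrow> star A (x \<oplus> y) = star A x \<oplus> star A y"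
  using star_conj_linear[of x y 1] by simp

lemma star_smult: "x \<in> carrier A \<Longrightarrow> star A (c \<odot> x) = bc_dagger3 c \<odot> star A x"
  using star_conj_linear[of x \<zero> c] by simp

lemma star_diff: "x \<in> carrier A \<Longrightarrow> y \<in> carrier A \<Longrightarrow> star A (x \<ominus> y) = star A x \<ominus> star A y"
  by (simp add: diff_eq star_add star_smult)

lemma dnorm_cases:
  assumes "x \<in> carrier A"
  obtains a b where "dnorm A x = hyp a b" "0 \<le> a" "0 \<le> b"
  using norm_nonneg[OF assms] by (auto simp: hyp_nonneg_def)

definition norm1 :: "'a \<Rightarrow> real" where "norm1 x = Re (bc_comp1 (dnorm A x))"
definition norm2 :: "'a \<Rightarrow> real" where "norm2 x = Re (bc_comp2 (dnorm A x))"

lemma dnorm_eq: "x \<in> carrier A \<Longrightarrow> dnorm A x = hyp (norm1 x) (norm2 x)"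
  by (erule dnorm_cases) (simp add: norm1_def norm2_def)

lemma norm1_component: "component_seminorm A norm1 bc_comp1"
proof
  fix x y c assume x: "x \<in> carrier A"
  show "0 \<le> norm1 x"
    using norm_nonneg[OF x] by (simp add: dnorm_eq x)
  show "norm1 (c \<odot> x) = cmod (bc_comp1 c) * norm1 x"
    using norm_smult[OF x, of c] x by (simp add: dnorm_eq hyp_modulus_def hyp_mult)
  show "norm1 (star A x \<otimes> x) = (norm1 x)\<^sup>2"
    using norm_star_mult[OF x] x by (simp add: dnorm_eq hyp_power2)
  assume y: "y \<in> carrier A"
  show "norm1 (x \<oplus> y) \<le> norm1 x + norm1 y"
    using norm_triangle[OF x y] x y by (simp add: dnorm_eq hyp_add)
  show "norm1 (x \<otimes> y) \<le> norm1 x * norm1 y"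
    using norm_mult[OF x y] x y by (simp add: dnorm_eq hyp_mult)
qed simp_all

lemma norm2_component: "component_seminorm A norm2 bc_comp2"
proof
  fix x y c assume x: "x \<in> carrier A"
  show "0 \<le> norm2 x"
    using norm_nonneg[OF x] by (simp add: dnorm_eq x)
  show "norm2 (c \<odot> x) = cmod (bc_comp2 c) * norm2 x"
    using norm_smult[OF x, of c] x by (simp add: dnorm_eq hyp_modulus_def hyp_mult)
  show "norm2 (star A x \<otimes> x) = (norm2 x)\<^sup>2"
    using norm_star_mult[OF x] x by (simp add: dnorm_eq hyp_power2)
  assume y: "y \<in> carrier A"
  show "norm2 (x \<oplus> y) \<le> norm2 x + norm2 y"
    using norm_triangle[OF x y] x y by (simp add: dnorm_eq hyp_add)
  show "norm2 (x \<otimes> y) \<le> norm2 x * norm2 y"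
    using norm_mult[OF x y] x y by (simp add: dnorm_eq hyp_mult)
qed simp_all

end

section \<open>Powers of a perturbed unit\<close>

context bc_algebra
begin

text \<open>Since \<open>A\<close> need not have a unit, a power \<open>(1 + v)\<^sup>j\<close> is represented by
  \<open>(1 + v)\<^sup>j - 1\<close>, which is a polynomial in \<open>v\<close> without constant term.\<close>

primrec qpow :: "'a \<Rightarrow> nat \<Rightarrow> 'a" where
  "qpow v 0 = \<zero>"
| "qpow v (Suc j) = qpow v j \<oplus> v \<oplus> qpow v j \<otimes> v"

primrec qpow_sum :: "'a \<Rightarrow> nat \<Rightarrow> 'a" where
  "qpow_sum v 0 = \<zero>"
| "qpow_sum v (Suc m) = qpow_sum v m \<oplus> qpow v m"

lemma qpow_closed [simp]: "v \<in> carrier A \<Longrightarrow> qpow v j \<in> carrier A"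
  by (induction j) simp_all

lemma qpow_sum_closed [simp]: "v \<in> carrier A \<Longrightarrow> qpow_sum v m \<in> carrier A"
  by (induction m) simp_all

text \<open>The recursion multiplies by v on the right, whereas telescoping produces v on the
  left.\<close>

lemma qpow_commute: "v \<in> carrier A \<Longrightarrow> v \<otimes> qpow v j = qpow v j \<otimes> v"
  by (induction j) (simp_all add: distrib_left distrib_right mult_assoc[symmetric])

lemma smult_of_Suc:
  "x \<in> carrier A \<Longrightarrow>
    bc_of_complex (of_nat (Suc m)) \<odot> x = bc_of_complex (of_nat m) \<odot> x \<oplus> x"
  by (simp add: smult_add_left bc_of_complex_one M.a_comm flip: bc_of_complex_add)

text \<open>This is the geometric sum v (1 + V + ... + V^(m-1)) = V^m - 1 for V = 1 + v. Each
  \<open>qpow\<close> omits the 1 of its power, and the m omitted units contribute the separate term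
  m v.\<close>

lemma qpow_telescope:
  assumes v: "v \<in> carrier A"
  shows "bc_of_complex (of_nat m) \<odot> v \<oplus> v \<otimes> qpow_sum v m = qpow v m"
proof (induction m)
  case 0
  then show ?case using v by (simp add: bc_of_complex_zero)
next
  case (Suc m)
  have "bc_of_complex (of_nat (Suc m)) \<odot> v = bc_of_complex (of_nat m) \<odot> v \<oplus> v"
    using v by (rule smult_of_Suc)
  then have "bc_of_complex (of_nat (Suc m)) \<odot> v \<oplus> v \<otimes> qpow_sum v (Suc m)
      = (bc_of_complex (of_nat m) \<odot> v \<oplus> v \<otimes> qpow_sum v m) \<oplus> v \<oplus> v \<otimes> qpow v m"
    using v by (simp add: distrib_left M.a_ac)
  then show ?case
    using v by (simp add: Suc.IH qpow_commute)
qed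

end

section \<open>Estimates in one component\<close>

context component_seminorm
begin

lemma n_zero [simp]: "n \<zero> = 0"
  using n_smult[of \<zero> "bc_of_complex 0"] by simp

lemma \<phi>_neg_one [simp]: "\<phi> (- 1) = - 1"
  using \<phi>_of_complex[of "-1"] by (simp add: bc_of_complex_minus bc_of_complex_one del: \<phi>_of_complex)

lemma \<phi>_diff: "\<phi> (c - d) = \<phi> c - \<phi> d"
  using \<phi>_add[of "c - d" d] by simp

lemma n_neg [simp]: "x \<in> carrier A \<Longrightarrow> n ((- 1) \<odot> x) = n x"
  by (simp add: n_smult)

lemma n_diff: "x \<in> carrier A \<Longrightarrow> y \<in> carrier A \<Longrightarrow> n (x \<ominus> y) \<le> n x + n y"
  using n_add[of x "(- 1) \<odot> y"] by (simp add: diff_eq)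

text \<open>The C*-identity and submultiplicativity bound the square of n z by n (star z) n z;
  cancelling n z gives one inequality, and applying it to the star of x gives the other.\<close>

lemma n_star [simp]:
  assumes x: "x \<in> carrier A"
  shows "n (star A x) = n x"
proof -
  have le: "n z \<le> n (star A z)" if z: "z \<in> carrier A" for z
  proof (cases "n z = 0")
    case False
    then have "n z > 0" using n_nonneg[OF z] by linarith
    moreover have "n z * n z \<le> n (star A z) * n z"
      using n_mult[of "star A z" z] z by (simp add: n_star_mult power2_eq_square)
    ultimately show ?thesis by simp
  qed (use z in simp)
  show ?thesis
    using le[OF x] le[of "star A x"] x by simp
qed

lemma n_mult_star: "x \<in> carrier A \<Longrightarrow> n (x \<otimes> star A x) = (n x)\<^sup>2"
  using n_star_mult[of "star A x"] by simp

text \<open>Here v is skew-adjoint, so the cross terms in the product of x + x v with its star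
  cancel. The excess over 1 is therefore quadratic in \<epsilon>, not linear as from the triangle
  inequality, and this keeps high powers of 1 + v bounded.\<close>

lemma n_one_plus_imaginary:
  assumes x: "x \<in> carrier A" and h: "h \<in> carrier A" "star A h = h"
    and v: "v = bc_of_complex (\<i> * of_real \<epsilon>) \<odot> h"
  shows "n (x \<oplus> x \<otimes> v) \<le> (1 + (\<epsilon> * n h)\<^sup>2) * n x"
proof -
  have vc: "v \<in> carrier A" using v h by simp
  have sv: "star A v = (- 1) \<odot> v"
    using v h by (simp add: star_smult smult_smult bc_of_complex_minus)
  have nv: "n v = \<bar>\<epsilon>\<bar> * n h"
    using v h by (simp add: n_smult Real_Vector_Spaces.norm_mult)
  have "(x \<oplus> x \<otimes> v) \<otimes> star A (x \<oplus> x \<otimes> v) = x \<otimes> star A x \<oplus> (x \<otimes> v) \<otimes> star A (x \<otimes> v)"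
    using x vc by (simp add: star_add star_mult sv algebra_normalize)
  then have "(n (x \<oplus> x \<otimes> v))\<^sup>2 = n (x \<otimes> star A x \<oplus> (x \<otimes> v) \<otimes> star A (x \<otimes> v))"
    using x vc by (simp flip: n_mult_star)
  also have "\<dots> \<le> (n x)\<^sup>2 + (n (x \<otimes> v))\<^sup>2"
    using x vc n_add[of "x \<otimes> star A x" "(x \<otimes> v) \<otimes> star A (x \<otimes> v)"] by (simp add: n_mult_star)
  also have "\<dots> \<le> (n x)\<^sup>2 + (n x * n v)\<^sup>2"
    using x vc by (intro add_left_mono power_mono n_mult) auto
  also have "\<dots> = (1 + (\<epsilon> * n h)\<^sup>2) * (n x)\<^sup>2"
    by (simp add: nv power_mult_distrib algebra_simps)
  \<comment> \<open>The factor is at least 1, so squaring it only weakens the bound and avoids a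
    square root in the statement.\<close>
  also have "\<dots> \<le> (1 + (\<epsilon> * n h)\<^sup>2)\<^sup>2 * (n x)\<^sup>2"
    by (intro mult_right_mono self_le_power) auto
  also have "\<dots> = ((1 + (\<epsilon> * n h)\<^sup>2) * n x)\<^sup>2"
    by (simp add: power_mult_distrib)
  finally show ?thesis
    by (rule power2_le_imp_le) (use x in simp)
qed

context
  fixes v C
  assumes v: "v \<in> carrier A" and C: "C \<ge> 1"
    and bound: "\<And>x. x \<in> carrier A \<Longrightarrow> n (x \<oplus> x \<otimes> v) \<le> C * n x"
begin

text \<open>With V = 1 + v, the element \<open>x \<oplus> x \<otimes> qpow v j\<close> stands for x
  V^j, so the one-step bound iterates.\<close>

lemma n_mult_qpow: "x \<in> carrier A \<Longrightarrow> n (x \<oplus> x \<otimes> qpow v j) \<le> C ^ j * n x"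
proof (induction j)
  case (Suc j)
  have "x \<oplus> x \<otimes> qpow v (Suc j) = (x \<oplus> x \<otimes> qpow v j) \<oplus> (x \<oplus> x \<otimes> qpow v j) \<otimes> v"
    using Suc.prems v by (simp add: distrib_left distrib_right mult_assoc M.a_ac)
  then have "n (x \<oplus> x \<otimes> qpow v (Suc j)) \<le> C * n (x \<oplus> x \<otimes> qpow v j)"
    using bound[of "x \<oplus> x \<otimes> qpow v j"] Suc.prems v by simp
  also have "\<dots> \<le> C * (C ^ j * n x)"
    using Suc C by (intro mult_left_mono) auto
  finally show ?case by (simp add: mult_ac)
qed simp

text \<open>The element on the left is the sum of x V^j over j < m, and each summand is bounded by
  C^m n x because C is at least 1.\<close>

lemma n_mult_qpow_sum:
  assumes x: "x \<in> carrier A"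
  shows "n (bc_of_complex (of_nat m) \<odot> x \<oplus> x \<otimes> qpow_sum v m) \<le> m * C ^ m * n x"
proof (induction m)
  case 0
  then show ?case using x by (simp add: bc_of_complex_zero)
next
  case (Suc m)
  let ?y = "bc_of_complex (of_nat m) \<odot> x \<oplus> x \<otimes> qpow_sum v m"
  have "bc_of_complex (of_nat (Suc m)) \<odot> x = bc_of_complex (of_nat m) \<odot> x \<oplus> x"
    using x by (rule smult_of_Suc)
  then have "bc_of_complex (of_nat (Suc m)) \<odot> x \<oplus> x \<otimes> qpow_sum v (Suc m)
      = ?y \<oplus> (x \<oplus> x \<otimes> qpow v m)"
    using x v by (simp add: distrib_left M.a_ac)
  then have "n (bc_of_complex (of_nat (Suc m)) \<odot> x \<oplus> x \<otimes> qpow_sum v (Suc m))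
      \<le> n ?y + n (x \<oplus> x \<otimes> qpow v m)"
    using x v n_add by simp
  also have "\<dots> \<le> m * C ^ m * n x + C ^ m * n x"
    by (intro add_mono Suc.IH n_mult_qpow x)
  also have "\<dots> = Suc m * C ^ m * n x"
    by (simp add: algebra_simps)
  also have "\<dots> \<le> Suc m * C ^ Suc m * n x"
    using C x by (intro mult_right_mono mult_left_mono power_increasing) auto
  finally show ?case .
qed

text \<open>Without a unit, \<open>n_mult_qpow\<close> cannot be applied to 1. For w = V^j - 1 it is
  applied to \<open>star A w\<close> instead: star(w) w = star(w) V^j - star(w), and the C*-identity
  then leaves one factor n w to cancel.\<close>

lemma n_qpow: "n (qpow v j) \<le> 1 + C ^ j"
proof (cases "n (qpow v j) = 0")
  case False
  let ?w = "qpow v j"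
  have w: "?w \<in> carrier A" using v by simp
  have pos: "n ?w > 0" using False n_nonneg[OF w] by linarith
  have "star A ?w \<otimes> ?w = (star A ?w \<oplus> star A ?w \<otimes> ?w) \<ominus> star A ?w"
    using w by (simp add: algebra_normalize)
  then have "n ?w * n ?w = n ((star A ?w \<oplus> star A ?w \<otimes> ?w) \<ominus> star A ?w)"
    using n_star_mult[OF w] by (simp add: power2_eq_square)
  also have "\<dots> \<le> n (star A ?w \<oplus> star A ?w \<otimes> ?w) + n (star A ?w)"
    using w by (intro n_diff) auto
  also have "\<dots> \<le> C ^ j * n (star A ?w) + n (star A ?w)"
    using w by (intro add_right_mono n_mult_qpow) auto
  also have "\<dots> = (1 + C ^ j) * n ?w"
    using w by (simp add: algebra_simps)
  finally show ?thesis using pos by simp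
qed (use C in \<open>auto intro: add_nonneg_nonneg\<close>)

end

lemma n_cesaro_bounds:
  fixes \<epsilon> :: real and m :: nat
  assumes h: "h \<in> carrier A" "star A h = h" and \<epsilon>: "\<epsilon> > 0" and m: "m > 0"
    and K: "(1 + (\<epsilon> * n h)\<^sup>2) ^ m \<le> K"
    and v: "v = bc_of_complex (\<i> * of_real \<epsilon>) \<odot> h"
    and q: "q = bc_of_complex (- 1 / of_nat m) \<odot> qpow_sum v m"
  shows "\<And>x. x \<in> carrier A \<Longrightarrow> n (x \<ominus> x \<otimes> q) \<le> K * n x"
    and "n (h \<ominus> h \<otimes> q) \<le> (1 + K) / (\<epsilon> * m)"
proof -
  let ?C = "1 + (\<epsilon> * n h)\<^sup>2"
  have vc: "v \<in> carrier A" using v h by simp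
  have C: "?C \<ge> 1" by simp
  note bnd = n_one_plus_imaginary[OF _ h v]
  \<comment> \<open>The factor -1/m in q makes 1 - q the average of 1, V, ..., V^(m-1) for V = 1 +
    v; the bracket is the sum of the x V^j.\<close>
  have eq: "x \<ominus> x \<otimes> q
      = bc_of_complex (1 / of_nat m) \<odot> (bc_of_complex (of_nat m) \<odot> x \<oplus> x \<otimes> qpow_sum v m)"
    if x: "x \<in> carrier A" for x
    using x vc m by (simp add: q algebra_normalize bc_of_complex_mult bc_of_complex_one
        flip: bc_of_complex_minus)
  show "n (x \<ominus> x \<otimes> q) \<le> K * n x" if x: "x \<in> carrier A" for x
  proof -
    have "n (x \<ominus> x \<otimes> q) \<le> (1 / m) * (m * ?C ^ m * n x)"
      using n_mult_qpow_sum[OF vc C bnd x, of m] x vc m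
      by (simp add: eq n_smult norm_divide divide_simps mult_ac)
    also have "\<dots> = ?C ^ m * n x" using m by simp
    also have "\<dots> \<le> K * n x" using K x by (intro mult_right_mono) auto
    finally show ?thesis .
  qed
  \<comment> \<open>Multiplying by i \<epsilon> turns both occurrences of h into v, so the sum
    telescopes.\<close>
  have "bc_of_complex (\<i> * of_real \<epsilon>) \<odot> (bc_of_complex (of_nat m) \<odot> h \<oplus> h \<otimes> qpow_sum v m)
      = qpow v m"
    using h vc by (simp flip: qpow_telescope)
      (simp add: v smult_add_right smult_smult smult_mult_left mult.commute)
  moreover have "n (bc_of_complex (\<i> * of_real \<epsilon>) \<odot> z) = \<epsilon> * n z" if "z \<in> carrier A" for z
    using that \<epsilon> by (simp add: n_smult Real_Vector_Spaces.norm_mult)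
  ultimately have "n (qpow v m) = \<epsilon> * n (bc_of_complex (of_nat m) \<odot> h \<oplus> h \<otimes> qpow_sum v m)"
    using h vc by (metis M.a_closed mult_closed qpow_sum_closed smult_closed')
  also have "\<dots> = \<epsilon> * (m * n (h \<ominus> h \<otimes> q))"
    using h vc m by (simp add: eq n_smult norm_divide)
  finally have "\<epsilon> * m * n (h \<ominus> h \<otimes> q) \<le> 1 + K"
    using n_qpow[OF vc C bnd, of m] K by simp
  then show "n (h \<ominus> h \<otimes> q) \<le> (1 + K) / (\<epsilon> * m)"
    using \<epsilon> m by (simp add: field_simps)
qed

text \<open>Transfers estimates on star(x) x (1 - q) to x (1 - q). For z = x (1 - q), the hypothesis
  strips 1 - q from the right of star(z) z at the cost of K; the isometry of the star then moves the
  other copy of 1 - q to the right end.\<close>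

lemma n_contract_sq:
  assumes x: "x \<in> carrier A" and q: "q \<in> carrier A"
    and K: "\<And>x. x \<in> carrier A \<Longrightarrow> n (x \<ominus> x \<otimes> q) \<le> K * n x"
  shows "(n (x \<ominus> x \<otimes> q))\<^sup>2 \<le> K * n (star A x \<otimes> x \<ominus> (star A x \<otimes> x) \<otimes> q)"
proof -
  define z where "z = x \<ominus> x \<otimes> q"
  have z: "z \<in> carrier A" using x q by (simp add: z_def)
  have "star A z \<otimes> z = (star A z \<otimes> x) \<ominus> (star A z \<otimes> x) \<otimes> q"
    using z x q by (subst (2) z_def) (simp add: algebra_normalize)
  then have "(n z)\<^sup>2 \<le> K * n (star A z \<otimes> x)"
    using K[of "star A z \<otimes> x"] z x by (simp flip: n_star_mult)
  also have "n (star A z \<otimes> x) = n (star A x \<otimes> z)"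
    using n_star[of "star A x \<otimes> z"] x z by (simp add: star_mult)
  also have "star A x \<otimes> z = star A x \<otimes> x \<ominus> (star A x \<otimes> x) \<otimes> q"
    using x q by (simp add: z_def algebra_normalize)
  finally show ?thesis by (simp add: z_def)
qed

end

section \<open>Approximate units and the distance to an ideal\<close>

locale cstar_ideal = bc_cstar_algebra A + bc_ideal I A for A (structure) and I
begin

lemma ideal_props:
  shows ideal_carrier [simp]: "y \<in> I \<Longrightarrow> y \<in> carrier A"
    and ideal_zero [simp]: "\<zero> \<in> I"
    and ideal_add [simp]: "y \<in> I \<Longrightarrow> z \<in> I \<Longrightarrow> y \<oplus> z \<in> I"
    and ideal_smult [simp]: "y \<in> I \<Longrightarrow> c \<odot> y \<in> I"
proof -
  note E = submoduleE[OF submodule_axioms]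
  show "y \<in> I \<Longrightarrow> y \<in> carrier A" using E(1) by blast
  show "y \<in> I \<Longrightarrow> z \<in> I \<Longrightarrow> y \<oplus> z \<in> I" by (rule E(5))
  show sm: "y \<in> I \<Longrightarrow> c \<odot> y \<in> I" for c y by (rule E(4)) simp
  obtain y where "y \<in> I" using E(2) by blast
  then have "0 \<odot> y \<in> I" "y \<in> carrier A" using sm E(1) by blast+
  then show "\<zero> \<in> I" by simp
qed

declare ideal_left [simp] ideal_right [simp]

lemma ideal_diff [simp]: "y \<in> I \<Longrightarrow> z \<in> I \<Longrightarrow> y \<ominus> z \<in> I"
  by (simp add: diff_eq)

text \<open>The absence of a constant term keeps these polynomials in I. Membership of the stars is
  carried along because I is not yet known to be self-adjoint.\<close>

lemma qpow_ideal: "v \<in> I \<Longrightarrow> star A v \<in> I \<Longrightarrow> qpow v j \<in> I \<and> star A (qpow v j) \<in> I"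
  by (induction j) (simp_all add: star_add star_mult)

lemma qpow_sum_ideal:
  "v \<in> I \<Longrightarrow> star A v \<in> I \<Longrightarrow> qpow_sum v m \<in> I \<and> star A (qpow_sum v m) \<in> I"
  by (induction m) (simp_all add: star_add qpow_ideal)

end

locale ideal_seminorm = cstar_ideal A I + component_seminorm A n \<phi>
  for A (structure) and I n \<phi>
begin

lemma approximate_unit:
  assumes y: "y \<in> I" and \<eta>: "\<eta> > 0"
  shows "\<exists>q\<in>I. star A q \<in> I \<and> (\<forall>x\<in>carrier A. n (x \<ominus> x \<otimes> q) \<le> (1 + \<eta>) * n x) \<and>
    n (y \<ominus> y \<otimes> q) \<le> \<eta>"
proof -
  \<comment> \<open>Although \<open>star A y\<close> is not known to lie in I, its product with y
    does, and this product is self-adjoint; hence v and q below lie in I together with their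
    stars.\<close>
  define h where "h = star A y \<otimes> y"
  have h: "h \<in> I" "h \<in> carrier A" "star A h = h"
    using y by (simp_all add: h_def star_mult)
  define K where "K N = exp ((n h)\<^sup>2 / real N)" for N :: nat
  have K: "K \<longlonglongrightarrow> exp 0"
    unfolding K_def by (intro tendsto_intros lim_const_over_n)
  \<comment> \<open>This is the final bound for the square of n (y - y q): a factor K from
    \<open>n_contract_sq\<close>, times (1 + K) / (\<epsilon> m) from
    \<open>n_cesaro_bounds\<close>, where \<epsilon> m = N.\<close>
  have "(\<lambda>N. K N * (1 + K N) * (1 / real N)) \<longlonglongrightarrow> exp 0 * (1 + exp 0) * 0"
    by (intro tendsto_intros K lim_const_over_n)
  then have "eventually (\<lambda>N. K N * (1 + K N) * (1 / real N) < \<eta>\<^sup>2) sequentially"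
    using \<eta> by (intro order_tendstoD(2)) auto
  moreover have "eventually (\<lambda>N. K N < 1 + \<eta>) sequentially"
    using K \<eta> by (intro order_tendstoD(2)) auto
  moreover have "eventually (\<lambda>N::nat. N > 0) sequentially"
    by (rule eventually_gt_at_top)
  ultimately have "eventually (\<lambda>N. K N * (1 + K N) * (1 / real N) < \<eta>\<^sup>2 \<and> K N < 1 + \<eta> \<and> N > 0) sequentially"
    by eventually_elim simp
  then obtain N where N: "K N * (1 + K N) * (1 / real N) < \<eta>\<^sup>2" "K N < 1 + \<eta>" "N > 0"
    using eventually_happens'[OF sequentially_bot] by blast
  define \<epsilon> where "\<epsilon> = 1 / (real N)\<^sup>2"
  define m where "m = N ^ 3"
  have \<epsilon>: "\<epsilon> > 0" and m: "m > 0" and \<epsilon>m: "\<epsilon> * m = N"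
    using N(3) by (simp_all add: \<epsilon>_def m_def power2_eq_square power3_eq_cube)
  \<comment> \<open>Uses 1 + t \<le> exp t; the choice of \<epsilon> and m makes m \<epsilon>^2 =
    1/N.\<close>
  have "(1 + (\<epsilon> * n h)\<^sup>2) ^ m \<le> exp ((\<epsilon> * n h)\<^sup>2) ^ m"
    by (intro power_mono) (auto simp: add_nonneg_nonneg)
  also have "\<dots> = exp (real m * (\<epsilon> * n h)\<^sup>2)"
    by (simp add: exp_of_nat_mult)
  also have "real m * (\<epsilon> * n h)\<^sup>2 = (n h)\<^sup>2 / real N"
    using N(3) by (simp add: \<epsilon>_def m_def field_simps power2_eq_square power3_eq_cube)
  finally have Km: "(1 + (\<epsilon> * n h)\<^sup>2) ^ m \<le> K N"
    by (simp add: K_def)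
  define v where "v = bc_of_complex (\<i> * of_real \<epsilon>) \<odot> h"
  define q where "q = bc_of_complex (- 1 / of_nat m) \<odot> qpow_sum v m"
  note bounds = n_cesaro_bounds[OF h(2,3) \<epsilon> m Km v_def q_def]
  have v: "v \<in> I" "star A v \<in> I" using h by (simp_all add: v_def star_smult)
  have q: "q \<in> I" "star A q \<in> I"
    using qpow_sum_ideal[OF v, of m] by (simp_all add: q_def star_smult)
  show ?thesis
  proof (intro bexI conjI ballI)
    show "n (x \<ominus> x \<otimes> q) \<le> (1 + \<eta>) * n x" if "x \<in> carrier A" for x
      using bounds(1)[OF that] N(2) that mult_right_mono[of "K N" "1 + \<eta>" "n x"] by simp
    have "(n (y \<ominus> y \<otimes> q))\<^sup>2 \<le> K N * n (h \<ominus> h \<otimes> q)"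
      unfolding h_def using y q bounds(1) by (intro n_contract_sq) auto
    also have "\<dots> \<le> K N * ((1 + K N) / (\<epsilon> * m))"
      using bounds(2) by (intro mult_left_mono) (auto simp: K_def)
    also have "\<dots> \<le> \<eta>\<^sup>2"
      using N(1) by (simp add: \<epsilon>m)
    finally show "n (y \<ominus> y \<otimes> q) \<le> \<eta>"
      by (rule power2_le_imp_le) (use \<eta> in simp)
  qed (use q in auto)
qed

section \<open>The distance to I as a quotient seminorm in one component\<close>

definition dist_ideal :: "'a \<Rightarrow> real" where
  "dist_ideal x = Inf {n (x \<ominus> y) | y. y \<in> I}"

lemma dist_set_bdd: "x \<in> carrier A \<Longrightarrow> bdd_below {n (x \<ominus> y) | y. y \<in> I}"
  by (rule bdd_belowI[of _ 0]) auto

lemma dist_set_nonempty: "{n (x \<ominus> y) | y. y \<in> I} \<noteq> {}"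
  using ideal_zero by blast

lemma dist_ideal_le: "x \<in> carrier A \<Longrightarrow> y \<in> I \<Longrightarrow> dist_ideal x \<le> n (x \<ominus> y)"
  unfolding dist_ideal_def by (rule cInf_lower[OF _ dist_set_bdd]) auto

lemma dist_ideal_le_n: "x \<in> carrier A \<Longrightarrow> dist_ideal x \<le> n x"
  using dist_ideal_le[of x \<zero>] by (simp add: diff_eq)

lemma dist_ideal_geI:
  "(\<And>y. y \<in> I \<Longrightarrow> c \<le> n (x \<ominus> y)) \<Longrightarrow> c \<le> dist_ideal x"
  unfolding dist_ideal_def using dist_set_nonempty by (auto intro: cInf_greatest)

lemma dist_ideal_nonneg: "x \<in> carrier A \<Longrightarrow> 0 \<le> dist_ideal x"
  by (rule dist_ideal_geI) simp

lemma dist_ideal_approx: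
  assumes "x \<in> carrier A" "\<eta> > 0"
  obtains y where "y \<in> I" "n (x \<ominus> y) < dist_ideal x + \<eta>"
proof -
  have "\<not> (\<forall>y\<in>I. dist_ideal x + \<eta> \<le> n (x \<ominus> y))"
    using dist_ideal_geI[of "dist_ideal x + \<eta>" x] assms(2) by fastforce
  then show ?thesis using that by fastforce
qed

lemma dist_ideal_add:
  assumes x: "x \<in> carrier A" and z: "z \<in> carrier A"
  shows "dist_ideal (x \<oplus> z) \<le> dist_ideal x + dist_ideal z"
proof (rule field_le_epsilon)
  fix e :: real assume "e > 0"
  then obtain y where y: "y \<in> I" "n (x \<ominus> y) < dist_ideal x + e / 2"
    using dist_ideal_approx[OF x, of "e/2"] \<open>e > 0\<close> by auto
  obtain w where w: "w \<in> I" "n (z \<ominus> w) < dist_ideal z + e / 2"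
    using dist_ideal_approx[OF z, of "e/2"] \<open>e > 0\<close> by auto
  have "dist_ideal (x \<oplus> z) \<le> n ((x \<oplus> z) \<ominus> (y \<oplus> w))"
    using x z y w by (intro dist_ideal_le) auto
  also have "(x \<oplus> z) \<ominus> (y \<oplus> w) = (x \<ominus> y) \<oplus> (z \<ominus> w)"
    using x z y w by (simp add: algebra_normalize)
  also have "n \<dots> \<le> n (x \<ominus> y) + n (z \<ominus> w)"
    using x z y w by (intro n_add) auto
  finally show "dist_ideal (x \<oplus> z) \<le> dist_ideal x + dist_ideal z + e"
    using y(2) w(2) by simp
qed

lemma dist_ideal_mult:
  assumes x: "x \<in> carrier A" and z: "z \<in> carrier A"
  shows "dist_ideal (x \<otimes> z) \<le> dist_ideal x * dist_ideal z"
proof -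
  have le: "dist_ideal (x \<otimes> z) \<le> (dist_ideal x + e) * (dist_ideal z + e)" if e: "e > 0" for e
  proof -
    obtain y where y: "y \<in> I" "n (x \<ominus> y) < dist_ideal x + e"
      by (rule dist_ideal_approx[OF x e])
    obtain w where w: "w \<in> I" "n (z \<ominus> w) < dist_ideal z + e"
      by (rule dist_ideal_approx[OF z e])
    \<comment> \<open>The element subtracted is x z - (x - y)(z - w), expanded so that every summand
      visibly has a factor in I.\<close>
    have "dist_ideal (x \<otimes> z) \<le> n ((x \<otimes> z) \<ominus> (x \<otimes> w \<oplus> y \<otimes> (z \<ominus> w)))"
      using x z y w by (intro dist_ideal_le) auto
    also have "(x \<otimes> z) \<ominus> (x \<otimes> w \<oplus> y \<otimes> (z \<ominus> w)) = (x \<ominus> y) \<otimes> (z \<ominus> w)"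
      using x z y w by (simp add: algebra_normalize)
    also have "n \<dots> \<le> n (x \<ominus> y) * n (z \<ominus> w)"
      using x z y w by (intro n_mult) auto
    also have "\<dots> \<le> (dist_ideal x + e) * (dist_ideal z + e)"
      using x z y w dist_ideal_nonneg[OF x] e by (intro mult_mono) auto
    finally show ?thesis .
  qed
  have "((\<lambda>e. (dist_ideal x + e) * (dist_ideal z + e))
      \<longlongrightarrow> (dist_ideal x + 0) * (dist_ideal z + 0)) (at_right 0)"
    by (intro tendsto_intros)
  moreover have "eventually (\<lambda>e. dist_ideal (x \<otimes> z) \<le> (dist_ideal x + e) * (dist_ideal z + e)) (at_right 0)"
    by (rule eventually_mono[OF eventually_at_right_less]) (rule le)
  ultimately show ?thesis
    by (auto dest: tendsto_lowerbound)
qed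

lemma dist_ideal_smult_le:
  assumes x: "x \<in> carrier A"
  shows "dist_ideal (c \<odot> x) \<le> cmod (\<phi> c) * dist_ideal x"
proof (cases "\<phi> c = 0")
  case True
  then show ?thesis using dist_ideal_le_n[of "c \<odot> x"] x by (simp add: n_smult)
next
  case False
  have "dist_ideal (c \<odot> x) / cmod (\<phi> c) \<le> dist_ideal x"
  proof (rule dist_ideal_geI)
    fix y assume y: "y \<in> I"
    have "dist_ideal (c \<odot> x) \<le> n (c \<odot> x \<ominus> c \<odot> y)"
      using x y by (intro dist_ideal_le) auto
    also have "c \<odot> x \<ominus> c \<odot> y = c \<odot> (x \<ominus> y)"
      using x y by (simp add: algebra_normalize)
    also have "n \<dots> = cmod (\<phi> c) * n (x \<ominus> y)"
      using x y by (simp add: n_smult)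
    finally show "dist_ideal (c \<odot> x) / cmod (\<phi> c) \<le> n (x \<ominus> y)"
      using False by (simp add: field_simps)
  qed
  then show ?thesis using False by (simp add: field_simps)
qed

lemma dist_ideal_smult:
  assumes x: "x \<in> carrier A"
  shows "dist_ideal (c \<odot> x) = cmod (\<phi> c) * dist_ideal x"
proof (rule antisym[OF dist_ideal_smult_le[OF x]])
  show "cmod (\<phi> c) * dist_ideal x \<le> dist_ideal (c \<odot> x)"
  proof (cases "\<phi> c = 0")
    case True
    then show ?thesis using dist_ideal_nonneg[of "c \<odot> x"] x by simp
  next
    case False
    \<comment> \<open>A zero divisor c can have \<open>\<phi> c\<close> nonzero, so x need not be
      recoverable from c x. Rescaling makes \<open>\<phi> a = 1\<close>, and the remainder (1 - a) x
      is invisible to this seminorm.\<close>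
    define a where "a = bc_of_complex (1 / \<phi> c) * c"
    have a: "\<phi> (1 - a) = 0"
      using False \<phi>_of_complex[of 1] by (simp add: a_def \<phi>_diff \<phi>_mult bc_of_complex_one)
    have "x = (1 - a) \<odot> x \<oplus> a \<odot> x"
      using smult_add_left[of x "1 - a" a] x by simp
    then have "dist_ideal x \<le> dist_ideal ((1 - a) \<odot> x) + dist_ideal (a \<odot> x)"
      using dist_ideal_add[of "(1 - a) \<odot> x" "a \<odot> x"] x by simp
    also have "dist_ideal ((1 - a) \<odot> x) \<le> 0"
      using dist_ideal_smult_le[OF x, of "1 - a"] a by simp
    also have "a \<odot> x = bc_of_complex (1 / \<phi> c) \<odot> (c \<odot> x)"
      using x by (simp add: a_def smult_smult)
    also have "dist_ideal \<dots> \<le> dist_ideal (c \<odot> x) / cmod (\<phi> c)"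
      using dist_ideal_smult_le[of "c \<odot> x" "bc_of_complex (1 / \<phi> c)"] x
      by (simp add: norm_divide)
    finally show ?thesis using False by (simp add: field_simps)
  qed
qed

text \<open>Taking the star of y - y q moves the approximate unit to the left of
  \<open>star A y\<close>. The subtracted product lies in I because \<open>star A q\<close> does,
  with no assumption on \<open>star A y\<close>.\<close>

lemma dist_ideal_star:
  assumes y: "y \<in> I"
  shows "dist_ideal (star A y) = 0"
proof -
  have "dist_ideal (star A y) \<le> 0 + e" if e: "e > 0" for e
  proof -
    obtain q where q: "q \<in> I" "star A q \<in> I" "n (y \<ominus> y \<otimes> q) \<le> e"
      using approximate_unit[OF y e] by blast
    have "dist_ideal (star A y) \<le> n (star A y \<ominus> star A q \<otimes> star A y)"
      using y q by (intro dist_ideal_le) auto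
    also have "star A y \<ominus> star A q \<otimes> star A y = star A (y \<ominus> y \<otimes> q)"
      using y q by (simp add: star_diff star_mult)
    also have "n \<dots> \<le> e"
      using y q by simp
    finally show ?thesis by simp
  qed
  then have "dist_ideal (star A y) \<le> 0" by (rule field_le_epsilon)
  then show ?thesis using dist_ideal_nonneg[of "star A y"] y by simp
qed

text \<open>Each competitor y in the infimum on the right gets an approximate unit q adapted to that
  y. As x q is in I, the distance of x is at most n (x - x q); by \<open>n_contract_sq\<close> it
  remains to estimate star(x) x (1 - q), where the part coming from y is nearly annihilated.\<close>

lemma dist_ideal_square_le:
  assumes x: "x \<in> carrier A"
  shows "(dist_ideal x)\<^sup>2 \<le> dist_ideal (star A x \<otimes> x)"
proof (rule dist_ideal_geI)
  fix y assume y: "y \<in> I"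
  define z where "z = star A x \<otimes> x \<ominus> y"
  have z: "z \<in> carrier A" using x y by (simp add: z_def)
  have zy: "star A x \<otimes> x = z \<oplus> y" using x y by (simp add: z_def algebra_normalize)
  have le: "(dist_ideal x)\<^sup>2 \<le> (1 + e) * ((1 + e) * n z + e)" if e: "e > 0" for e
  proof -
    obtain q where q: "q \<in> I" "\<And>x. x \<in> carrier A \<Longrightarrow> n (x \<ominus> x \<otimes> q) \<le> (1 + e) * n x"
      "n (y \<ominus> y \<otimes> q) \<le> e"
      using approximate_unit[OF y e] by blast
    have "(dist_ideal x)\<^sup>2 \<le> (n (x \<ominus> x \<otimes> q))\<^sup>2"
      using x q dist_ideal_nonneg by (intro power_mono dist_ideal_le) auto
    also have "\<dots> \<le> (1 + e) * n (star A x \<otimes> x \<ominus> (star A x \<otimes> x) \<otimes> q)"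
      using x q by (intro n_contract_sq) auto
    also have "star A x \<otimes> x \<ominus> (star A x \<otimes> x) \<otimes> q = (z \<ominus> z \<otimes> q) \<oplus> (y \<ominus> y \<otimes> q)"
      using z y q by (simp add: zy algebra_normalize)
    also have "(1 + e) * n \<dots> \<le> (1 + e) * (n (z \<ominus> z \<otimes> q) + n (y \<ominus> y \<otimes> q))"
      using z y q e by (intro mult_left_mono n_add) auto
    also have "\<dots> \<le> (1 + e) * ((1 + e) * n z + e)"
      using z q e by (intro mult_left_mono add_mono) auto
    finally show ?thesis .
  qed
  have "((\<lambda>e. (1 + e) * ((1 + e) * n z + e)) \<longlongrightarrow> (1 + 0) * ((1 + 0) * n z + 0)) (at_right 0)"
    by (intro tendsto_intros)
  moreover have "eventually (\<lambda>e. (dist_ideal x)\<^sup>2 \<le> (1 + e) * ((1 + e) * n z + e)) (at_right 0)"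
    by (rule eventually_mono[OF eventually_at_right_less]) (rule le)
  ultimately show "(dist_ideal x)\<^sup>2 \<le> n z"
    by (auto dest: tendsto_lowerbound)
qed

text \<open>Self-adjointness of I is a hypothesis at this stage; it is derived from closedness in
  \<open>star_ideal\<close>.\<close>

lemma dist_ideal_star_le:
  assumes x: "x \<in> carrier A" and I: "\<And>y. y \<in> I \<Longrightarrow> star A y \<in> I"
  shows "dist_ideal (star A x) \<le> dist_ideal x"
proof (rule dist_ideal_geI)
  fix y assume y: "y \<in> I"
  have "dist_ideal (star A x) \<le> n (star A x \<ominus> star A y)"
    using x y I by (intro dist_ideal_le) auto
  also have "star A x \<ominus> star A y = star A (x \<ominus> y)"
    using x y by (simp add: star_diff)
  finally show "dist_ideal (star A x) \<le> n (x \<ominus> y)" using x y by simp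
qed

lemma dist_ideal_star_mult:
  assumes x: "x \<in> carrier A" and I: "\<And>y. y \<in> I \<Longrightarrow> star A y \<in> I"
  shows "dist_ideal (star A x \<otimes> x) = (dist_ideal x)\<^sup>2"
proof (rule antisym[OF _ dist_ideal_square_le[OF x]])
  have "dist_ideal (star A x \<otimes> x) \<le> dist_ideal (star A x) * dist_ideal x"
    using x by (simp add: dist_ideal_mult)
  also have "\<dots> \<le> dist_ideal x * dist_ideal x"
    using x dist_ideal_star_le[OF x I] dist_ideal_nonneg by (intro mult_right_mono) auto
  finally show "dist_ideal (star A x \<otimes> x) \<le> (dist_ideal x)\<^sup>2"
    by (simp add: power2_eq_square)
qed

end

section \<open>The quotient algebra\<close>

text \<open>Testing on the diagonal \<open>hyp e e\<close> suffices, since \<open>hyp a b\<close>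
  dominates it for e = min a b. The index sets S N are left abstract to cover convergence (tails)
  and the Cauchy property (products of tails) at once.\<close>

lemma hyp_pos_le_iff:
  "(\<forall>\<epsilon>\<in>hyp_pos. \<exists>N::nat. \<forall>p\<in>S N. hyp (f p) (g p) \<le>\<^sub>D \<epsilon>) \<longleftrightarrow>
    (\<forall>e>0. \<exists>N. \<forall>p\<in>S N. f p \<le> e \<and> g p \<le> e)"
proof (intro iffI allI impI ballI)
  fix e :: real assume L: "\<forall>\<epsilon>\<in>hyp_pos. \<exists>N. \<forall>p\<in>S N. hyp (f p) (g p) \<le>\<^sub>D \<epsilon>" and "e > 0"
  then show "\<exists>N. \<forall>p\<in>S N. f p \<le> e \<and> g p \<le> e"
    using L[rule_format, of "hyp e e"] by simp
next
  fix \<epsilon> assume R: "\<forall>e>0. \<exists>N. \<forall>p\<in>S N. f p \<le> e \<and> g p \<le> e" and "\<epsilon> \<in> hyp_pos"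
  then obtain a b where ab: "\<epsilon> = hyp a b" "a > 0" "b > 0" by (auto simp: hyp_pos_def)
  then obtain N where "\<forall>p\<in>S N. f p \<le> min a b \<and> g p \<le> min a b"
    using R[rule_format, of "min a b"] by auto
  then show "\<exists>N. \<forall>p\<in>S N. hyp (f p) (g p) \<le>\<^sub>D \<epsilon>"
    using ab by auto
qed

section \<open>Convergence and Cauchy sequences in components\<close>

context bc_cstar_algebra
begin

lemma D_converges_iff:
  assumes "range u \<subseteq> carrier A" "l \<in> carrier A"
  shows "D_converges A u l \<longleftrightarrow>
    (\<forall>e>0. \<exists>N. \<forall>n\<ge>N. norm1 (u n \<ominus> l) \<le> e \<and> norm2 (u n \<ominus> l) \<le> e)"
proof -
  have "D_converges A u l \<longleftrightarrow> (\<forall>\<epsilon>\<in>hyp_pos. \<exists>N. \<forall>n\<in>{N..}. hyp (norm1 (u n \<ominus> l)) (norm2 (u n \<ominus> l)) \<le>\<^sub>D \<epsilon>)"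
    using assms by (simp add: D_converges_def Ball_def imp_conjL image_subset_iff flip: dnorm_eq)
  then show ?thesis unfolding hyp_pos_le_iff by (simp add: Ball_def)
qed

lemma D_Cauchy_iff:
  assumes "range u \<subseteq> carrier A"
  shows "D_Cauchy A u \<longleftrightarrow>
    (\<forall>e>0. \<exists>N. \<forall>m\<ge>N. \<forall>n\<ge>N. norm1 (u m \<ominus> u n) \<le> e \<and> norm2 (u m \<ominus> u n) \<le> e)"
proof -
  have "D_Cauchy A u \<longleftrightarrow> (\<forall>\<epsilon>\<in>hyp_pos. \<exists>N. \<forall>p\<in>{N..} \<times> {N..}.
      hyp (norm1 (u (fst p) \<ominus> u (snd p))) (norm2 (u (fst p) \<ominus> u (snd p))) \<le>\<^sub>D \<epsilon>)"
    using assms by (simp add: D_Cauchy_def Ball_def imp_conjL image_subset_iff flip: dnorm_eq)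
  then show ?thesis unfolding hyp_pos_le_iff by (simp add: Ball_def imp_conjL)
qed

end

lemma (in component_seminorm) n_diff_commute:
  assumes "x \<in> carrier A" "y \<in> carrier A"
  shows "n (x \<ominus> y) = n (y \<ominus> x)"
proof -
  have "x \<ominus> y = (- 1) \<odot> (y \<ominus> x)"
    using assms by (simp add: algebra_normalize)
  then show ?thesis using assms by simp
qed

lemma (in component_seminorm) n_fast_Cauchy:
  assumes x: "\<And>k. x k \<in> carrier A" and step: "\<And>k. n (x (Suc k) \<ominus> x k) \<le> 2 * (1/2) ^ k"
  shows "n (x (k + j) \<ominus> x k) \<le> 4 * (1/2) ^ k"
proof -
  \<comment> \<open>The exact partial geometric sum is needed for the induction to close; the cruder
    bound would grow at each step.\<close>
  have "n (x (k + j) \<ominus> x k) \<le> 4 * (1/2) ^ k * (1 - (1/2) ^ j)"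
  proof (induction j)
    case 0
    then show ?case using x by (simp add: diff_eq)
  next
    case (Suc j)
    have "x (k + Suc j) \<ominus> x k = (x (Suc (k + j)) \<ominus> x (k + j)) \<oplus> (x (k + j) \<ominus> x k)"
      using x by (simp add: diff_eq M.a_assoc)
    then have "n (x (k + Suc j) \<ominus> x k) \<le> n (x (Suc (k + j)) \<ominus> x (k + j)) + n (x (k + j) \<ominus> x k)"
      using x n_add by simp
    also have "\<dots> \<le> 2 * (1/2) ^ (k + j) + 4 * (1/2) ^ k * (1 - (1/2) ^ j)"
      by (intro add_mono step Suc.IH)
    also have "\<dots> = 4 * (1/2) ^ k * (1 - (1/2) ^ Suc j)"
      by (simp add: algebra_simps power_add)
    finally show ?case .
  qed
  also have "\<dots> \<le> 4 * (1/2) ^ k" by (simp add: algebra_simps)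
  finally show ?thesis .
qed

section \<open>Closed ideals and their self-adjointness\<close>

locale cstar_closed_ideal = cstar_ideal A I for A (structure) and I +
  assumes closed: "D_closed A I"
begin

interpretation N1: ideal_seminorm A I norm1 bc_comp1
  by (intro ideal_seminorm.intro norm1_component cstar_ideal_axioms)

interpretation N2: ideal_seminorm A I norm2 bc_comp2
  by (intro ideal_seminorm.intro norm2_component cstar_ideal_axioms)

abbreviation "dist1 \<equiv> N1.dist_ideal"
abbreviation "dist2 \<equiv> N2.dist_ideal"

text \<open>The two infima are approximated simultaneously because the components of an element of
  \<open>I\<close> can be chosen independently.\<close>

lemma joint_approx:
  assumes x: "x \<in> carrier A" and \<eta>: "\<eta> > 0"
  shows "\<exists>y\<in>I. norm1 (x \<ominus> y) < dist1 x + \<eta> \<and> norm2 (x \<ominus> y) < dist2 x + \<eta>"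
proof -
  obtain y where y: "y \<in> I" "norm1 (x \<ominus> y) < dist1 x + \<eta>"
    by (rule N1.dist_ideal_approx[OF x \<eta>])
  obtain z where z: "z \<in> I" "norm2 (x \<ominus> z) < dist2 x + \<eta>"
    by (rule N2.dist_ideal_approx[OF x \<eta>])
  let ?w = "bc_e1 \<odot> y \<oplus> bc_e2 \<odot> z"
  have "x = bc_e1 \<odot> x \<oplus> bc_e2 \<odot> x"
    using x by (simp flip: smult_add_left add: bc_e1_plus_e2)
  then have "x \<ominus> ?w = (bc_e1 \<odot> x \<oplus> bc_e2 \<odot> x) \<ominus> ?w" by simp
  also have "\<dots> = bc_e1 \<odot> (x \<ominus> y) \<oplus> bc_e2 \<odot> (x \<ominus> z)"
    using x y z by (simp add: algebra_normalize mult.commute)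
  finally have eq: "x \<ominus> ?w = bc_e1 \<odot> (x \<ominus> y) \<oplus> bc_e2 \<odot> (x \<ominus> z)" .
  \<comment> \<open>Each component seminorm annihilates multiples of the other idempotent, so only
    one summand survives in each estimate.\<close>
  have "norm1 (x \<ominus> ?w) \<le> norm1 (x \<ominus> y)"
    using N1.n_add[of "bc_e1 \<odot> (x \<ominus> y)" "bc_e2 \<odot> (x \<ominus> z)"] x y z by (simp add: eq N1.n_smult)
  moreover have "norm2 (x \<ominus> ?w) \<le> norm2 (x \<ominus> z)"
    using N2.n_add[of "bc_e1 \<odot> (x \<ominus> y)" "bc_e2 \<odot> (x \<ominus> z)"] x y z by (simp add: eq N2.n_smult)
  moreover have "?w \<in> I" using y z by simp
  ultimately show ?thesis
    using y(2) z(2) by (intro bexI[of _ ?w]) auto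
qed

text \<open>This is where closedness enters. Vanishing of both distances gives, through
  \<open>joint_approx\<close>, a single sequence in I converging to x in both components.\<close>

lemma mem_ideal_iff_dist:
  assumes x: "x \<in> carrier A"
  shows "dist1 x = 0 \<and> dist2 x = 0 \<longleftrightarrow> x \<in> I"
proof
  assume "x \<in> I"
  then have "dist1 x \<le> norm1 (x \<ominus> x)" "dist2 x \<le> norm2 (x \<ominus> x)"
    using x by (auto intro: N1.dist_ideal_le N2.dist_ideal_le)
  then show "dist1 x = 0 \<and> dist2 x = 0"
    using x N1.dist_ideal_nonneg[OF x] N2.dist_ideal_nonneg[OF x] by (simp add: diff_eq)
next
  assume 0: "dist1 x = 0 \<and> dist2 x = 0"
  have "\<forall>k::nat. \<exists>y\<in>I. norm1 (x \<ominus> y) < inverse (Suc k) \<and> norm2 (x \<ominus> y) < inverse (Suc k)"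
    using joint_approx[OF x] 0 by simp
  then obtain y where y: "\<And>k. y k \<in> I" "\<And>k. norm1 (x \<ominus> y k) < inverse (Suc k)"
    "\<And>k. norm2 (x \<ominus> y k) < inverse (Suc k)"
    by metis
  have "D_converges A y x"
  proof (subst D_converges_iff, safe)
    fix e :: real assume "e > 0"
    then obtain N where N: "inverse (real (Suc N)) < e" using reals_Archimedean by blast
    have "norm1 (y k \<ominus> x) \<le> e \<and> norm2 (y k \<ominus> x) \<le> e" if "k \<ge> N" for k
    proof -
      have "inverse (real (Suc k)) < e"
        using that by (intro le_less_trans[OF _ N]) (simp add: field_simps)
      then show ?thesis
        using y(2,3)[of k] y(1)[of k] x N1.n_diff_commute[of x "y k"] N2.n_diff_commute[of x "y k"]
        by simp
    qed
    then show "\<exists>N. \<forall>n\<ge>N. norm1 (y n \<ominus> x) \<le> e \<and> norm2 (y n \<ominus> x) \<le> e" by blast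
  qed (use x y in auto)
  then show "x \<in> I"
    using closed x y(1) unfolding D_closed_def by blast
qed

lemma star_ideal [simp]: "y \<in> I \<Longrightarrow> star A y \<in> I"
  using N1.dist_ideal_star N2.dist_ideal_star by (simp flip: mem_ideal_iff_dist)

section \<open>Operations and norm on cosets\<close>

abbreviation "AI \<equiv> bc_quotient A I"

lemmas quotient_context = bc_algebra_axioms bc_ideal_axioms

lemma carrier_Q: "Z \<in> carrier AI \<longleftrightarrow> (\<exists>x\<in>carrier A. Z = I +> x)"
  by (auto simp: bc_quotient_def A_RCOSETS_def')

lemma carrier_QE:
  assumes "Z \<in> carrier AI"
  obtains x where "x \<in> carrier A" "Z = I +> x"
  using assms carrier_Q by blast

lemma coset_in_Q [simp]: "x \<in> carrier A \<Longrightarrow> I +> x \<in> carrier AI"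
  using carrier_Q by blast

lemma coset_self: "x \<in> carrier A \<Longrightarrow> x \<in> I +> x"
  by (rule abelian_subgroup.a_rcos_self[OF ideal_abelian_subgroup[OF quotient_context]])

lemma coset_zero: "I +> \<zero> = I"
  using ideal_carrier by (auto simp: a_r_coset_def')

lemma coset_eq_ideal_iff: "x \<in> carrier A \<Longrightarrow> I +> x = I \<longleftrightarrow> x \<in> I"
  using coset_self coset_absorb[OF quotient_context, of x \<zero>] by (auto simp: coset_zero)

lemma zero_Q: "\<zero>\<^bsub>AI\<^esub> = I"
  by (simp add: bc_quotient_def)

lemmas add_Q [simp] = add_bc_quotient[OF quotient_context]
  and mult_Q [simp] = mult_bc_quotient[OF quotient_context]
  and smult_Q [simp] = smult_bc_quotient[OF quotient_context]

lemma star_Q: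
  assumes x: "x \<in> carrier A"
  shows "star AI (I +> x) = I +> star A x"
proof -
  have eq: "I +> star A x' = I +> star A x" if x': "x' \<in> I +> x" for x'
  proof -
    obtain h where h: "h \<in> I" "x' = h \<oplus> x"
      using mem_cosetD[OF quotient_context x'] by blast
    \<comment> \<open>Independence of the representative amounts to \<open>star A h\<close> \<in> I,
      that is, to self-adjointness of I.\<close>
    then show ?thesis
      using x coset_absorb[OF quotient_context, of "star A h" "star A x"] by (simp add: star_add)
  qed
  have "star AI (I +> x) = (\<Union>x'\<in>I +> x. I +> star A x')"
    by (simp add: bc_quotient_def)
  also have "\<dots> = (\<Union>x'\<in>I +> x. I +> star A x)"
    by (intro SUP_cong refl eq)
  also have "\<dots> = I +> star A x"
    using coset_self[OF x] by auto
  finally show ?thesis .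
qed

text \<open>An infimum for the hyperbolic order is taken componentwise, so it splits into the two
  real distances even though both components range over the same y.\<close>

lemma dnorm_Q:
  assumes x: "x \<in> carrier A"
  shows "dnorm AI (I +> x) = hyp (dist1 x) (dist2 x)"
proof -
  define P where "P = {(norm1 (x \<ominus> y), norm2 (x \<ominus> y)) | y. y \<in> I}"
  have f: "fst ` P = {norm1 (x \<ominus> y) | y. y \<in> I}" and s: "snd ` P = {norm2 (x \<ominus> y) | y. y \<in> I}"
    by (force simp: P_def)+
  have "P \<noteq> {}" using ideal_zero unfolding P_def by blast
  have "{dnorm A (x \<ominus> y) | y. y \<in> I} = case_prod hyp ` P"
  proof -
    have "case_prod hyp ` P = {hyp (norm1 (x \<ominus> y)) (norm2 (x \<ominus> y)) | y. y \<in> I}"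
      by (force simp: P_def)
    also have "\<dots> = {dnorm A (x \<ominus> y) | y. y \<in> I}"
      using x by (intro Collect_cong ex_cong1) (auto simp: dnorm_eq)
    finally show ?thesis by simp
  qed
  then show ?thesis
    using hyp_Inf_componentwise[OF \<open>P \<noteq> {}\<close>] N1.dist_set_bdd[OF x] N2.dist_set_bdd[OF x]
    by (simp add: dnorm_bc_quotient[OF quotient_context x] f s N1.dist_ideal_def N2.dist_ideal_def)
qed

lemma quotient_algebra: "bc_algebra AI"
proof (intro bc_algebra.intro moduleI abelian_groupI bc_algebra_axioms.intro)
  show "cring BC" by (rule R.is_cring)
  show "\<zero>\<^bsub>AI\<^esub> \<in> carrier AI"
    using coset_in_Q[of \<zero>] by (simp add: zero_Q coset_zero)
  show "\<exists>Y\<in>carrier AI. Y \<oplus>\<^bsub>AI\<^esub> Z = \<zero>\<^bsub>AI\<^esub>" if "Z \<in> carrier AI" for Z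
  proof -
    obtain x where x: "x \<in> carrier A" "Z = I +> x" using \<open>Z \<in> carrier AI\<close> by (rule carrier_QE)
    then show ?thesis
      by (intro bexI[of _ "I +> ((- 1) \<odot> x)"]) (simp_all add: zero_Q coset_zero)
  qed
  show "\<zero>\<^bsub>AI\<^esub> \<oplus>\<^bsub>AI\<^esub> Z = Z" if "Z \<in> carrier AI" for Z
    using that add_Q[of \<zero>] by (auto elim!: carrier_QE simp: zero_Q coset_zero)
qed (auto elim!: carrier_QE simp: M.a_ac smult_add_left smult_add_right smult_smult mult_assoc
    distrib_left distrib_right smult_mult_left smult_mult_right[symmetric])

interpretation Q: bc_algebra AI by (rule quotient_algebra)

lemma diff_Q: "x \<in> carrier A \<Longrightarrow> y \<in> carrier A \<Longrightarrow> (I +> x) \<ominus>\<^bsub>AI\<^esub> (I +> y) = I +> (x \<ominus> y)"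
  by (simp add: Q.diff_eq diff_eq)

text \<open>Representatives along a fast subsequence are corrected by elements of I to form a Cauchy
  sequence in A. The coset of its limit is the limit of that subsequence, hence of the whole Cauchy
  sequence.\<close>

lemma quotient_complete:
  assumes U: "range U \<subseteq> carrier AI" "D_Cauchy AI U"
  shows "\<exists>L\<in>carrier AI. D_converges AI U L"
proof -
  have "\<forall>k. \<exists>x\<in>carrier A. U k = I +> x" using U(1) carrier_Q by blast
  then obtain u where u [simp]: "\<And>k. u k \<in> carrier A" and U_eq: "\<And>k. U k = I +> u k"
    by metis
  have "\<forall>\<epsilon>\<in>hyp_pos. \<exists>N. \<forall>p\<in>{N..} \<times> {N..}.
      hyp (dist1 (u (fst p) \<ominus> u (snd p))) (dist2 (u (fst p) \<ominus> u (snd p))) \<le>\<^sub>D \<epsilon>"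
    using U(2) by (simp add: D_Cauchy_def U_eq diff_Q dnorm_Q Ball_def imp_conjL)
  then have Cauchy: "\<forall>e>0. \<exists>N. \<forall>m\<ge>N. \<forall>n\<ge>N. dist1 (u m \<ominus> u n) \<le> e \<and> dist2 (u m \<ominus> u n) \<le> e"
    unfolding hyp_pos_le_iff by (simp add: Ball_def imp_conjL)
  have "\<forall>k. \<exists>N. \<forall>m\<ge>N. \<forall>n\<ge>N. dist1 (u m \<ominus> u n) \<le> (1/2) ^ k \<and> dist2 (u m \<ominus> u n) \<le> (1/2) ^ k"
    using Cauchy by simp
  then obtain N where N: "\<And>k m n. N k \<le> m \<Longrightarrow> N k \<le> n \<Longrightarrow>
      dist1 (u m \<ominus> u n) \<le> (1/2) ^ k \<and> dist2 (u m \<ominus> u n) \<le> (1/2) ^ k"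
    by metis
  \<comment> \<open>The sum dominates all thresholds N j with j \<le> k, so both r k and r (Suc k)
    are beyond N k.\<close>
  define r where "r k = (\<Sum>j\<le>k. N j)" for k
  have r: "N j \<le> r k" if "j \<le> k" for j k
    unfolding r_def using that by (intro member_le_sum) auto
  have "\<forall>k. \<exists>y\<in>I. norm1 (u (r (Suc k)) \<ominus> u (r k) \<ominus> y) \<le> 2 * (1/2) ^ k \<and>
      norm2 (u (r (Suc k)) \<ominus> u (r k) \<ominus> y) \<le> 2 * (1/2) ^ k"
  proof
    fix k
    obtain y where "y \<in> I"
      "norm1 (u (r (Suc k)) \<ominus> u (r k) \<ominus> y) < dist1 (u (r (Suc k)) \<ominus> u (r k)) + (1/2) ^ k"
      "norm2 (u (r (Suc k)) \<ominus> u (r k) \<ominus> y) < dist2 (u (r (Suc k)) \<ominus> u (r k)) + (1/2) ^ k"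
      using joint_approx[of "u (r (Suc k)) \<ominus> u (r k)" "(1/2) ^ k"] by auto
    moreover note N[OF r[of k "Suc k"] r[of k k]]
    ultimately show "\<exists>y\<in>I. norm1 (u (r (Suc k)) \<ominus> u (r k) \<ominus> y) \<le> 2 * (1/2) ^ k \<and>
      norm2 (u (r (Suc k)) \<ominus> u (r k) \<ominus> y) \<le> 2 * (1/2) ^ k"
      by (intro bexI[of _ y]) auto
  qed
  then obtain y where y [simp]: "\<And>k. y k \<in> I"
    and ny: "\<And>k. norm1 (u (r (Suc k)) \<ominus> u (r k) \<ominus> y k) \<le> 2 * (1/2) ^ k"
      "\<And>k. norm2 (u (r (Suc k)) \<ominus> u (r k) \<ominus> y k) \<le> 2 * (1/2) ^ k"
    by metis
  \<comment> \<open>Accumulating the corrections makes the k-th increment of x differ from that of u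
    along r by exactly y k.\<close>
  define Y where "Y = rec_nat \<zero> (\<lambda>k a. a \<oplus> y k)"
  have Y_simps: "Y 0 = \<zero>" "Y (Suc k) = Y k \<oplus> y k" for k by (simp_all add: Y_def)
  have Y [simp]: "Y k \<in> I" for k by (induction k) (simp_all add: Y_simps)
  define x where "x k = u (r k) \<ominus> Y k" for k
  have x [simp]: "x k \<in> carrier A" for k by (simp add: x_def)
  have "x (Suc k) \<ominus> x k = u (r (Suc k)) \<ominus> u (r k) \<ominus> y k" for k
  proof -
    have "x (Suc k) \<ominus> x k = Y k \<oplus> ((- 1) \<odot> Y k \<oplus> (u (r (Suc k)) \<ominus> u (r k) \<ominus> y k))"
      by (simp add: x_def Y_simps algebra_normalize del: add_neg_smult_left)
    then show ?thesis by simp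
  qed
  then have fast: "norm1 (x (k + j) \<ominus> x k) \<le> 4 * (1/2) ^ k" "norm2 (x (k + j) \<ominus> x k) \<le> 4 * (1/2) ^ k" for k j
    using ny by (auto intro!: N1.n_fast_Cauchy N2.n_fast_Cauchy)
  have xr: "range x \<subseteq> carrier A" using x by blast
  have "D_Cauchy A x"
  proof (subst D_Cauchy_iff, safe)
    fix e :: real assume e: "e > 0"
    \<comment> \<open>Two tails starting at k, each of size at most 4 (1/2)^k, must add up to at
      most e; hence e / 8.\<close>
    then obtain k where k: "(1/2) ^ k < e / 8" using real_arch_pow_inv[of "e/8" "1/2"] by auto
    have "norm1 (x m \<ominus> x n) \<le> e \<and> norm2 (x m \<ominus> x n) \<le> e" if mn: "m \<ge> k" "n \<ge> k" for m n
    proof -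
      obtain i j where ij: "m = k + i" "n = k + j" using mn le_Suc_ex by metis
      have eq: "x m \<ominus> x n = (x m \<ominus> x k) \<ominus> (x n \<ominus> x k)"
        by (simp add: algebra_normalize)
      show ?thesis
        using N1.n_diff[of "x m \<ominus> x k" "x n \<ominus> x k"] N2.n_diff[of "x m \<ominus> x k" "x n \<ominus> x k"]
          fast[of k i] fast[of k j] k unfolding eq by (simp add: ij)
    qed
    then show "\<exists>N. \<forall>m\<ge>N. \<forall>n\<ge>N. norm1 (x m \<ominus> x n) \<le> e \<and> norm2 (x m \<ominus> x n) \<le> e" by blast
  qed auto
  then obtain l where l [simp]: "l \<in> carrier A" and lim: "D_converges A x l"
    using complete[OF xr] by blast
  have "\<forall>\<epsilon>\<in>hyp_pos. \<exists>M. \<forall>n\<in>{M..}. hyp (dist1 (u n \<ominus> l)) (dist2 (u n \<ominus> l)) \<le>\<^sub>D \<epsilon>"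
    unfolding hyp_pos_le_iff
  proof (intro allI impI)
    fix e :: real assume e: "e > 0"
    obtain k where k: "(1/2) ^ k < e / 2" using real_arch_pow_inv[of "e/2" "1/2"] e by auto
    obtain M where M: "\<And>n. n \<ge> M \<Longrightarrow> norm1 (x n \<ominus> l) \<le> e/2 \<and> norm2 (x n \<ominus> l) \<le> e/2"
      using lim e unfolding D_converges_iff[OF xr l] by (meson half_gt_zero)
    \<comment> \<open>The bound j \<ge> M brings x j close to l, and j \<ge> k puts r j beyond N k,
      so that u n can be compared with u (r j).\<close>
    define j where "j = max k M"
    have j: "j \<ge> M" by (simp add: j_def)
    have eqx: "x j \<ominus> l = (u (r j) \<ominus> l) \<ominus> Y j"
      by (simp add: x_def algebra_normalize)
    \<comment> \<open>Since Y j is in I, the norm of x j - l bounds the distance of u (r j) - l to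
      I.\<close>
    have lim_j: "dist1 (u (r j) \<ominus> l) \<le> e/2" "dist2 (u (r j) \<ominus> l) \<le> e/2"
      using N1.dist_ideal_le[of "u (r j) \<ominus> l" "Y j"] N2.dist_ideal_le[of "u (r j) \<ominus> l" "Y j"]
        M[OF j] unfolding eqx by simp_all
    have "dist1 (u n \<ominus> l) \<le> e \<and> dist2 (u n \<ominus> l) \<le> e" if n: "n \<ge> N k" for n
    proof -
      have "u n \<ominus> l = (u n \<ominus> u (r j)) \<oplus> (u (r j) \<ominus> l)"
        by (simp add: diff_eq M.a_assoc)
      then have "dist1 (u n \<ominus> l) \<le> dist1 (u n \<ominus> u (r j)) + dist1 (u (r j) \<ominus> l)"
        "dist2 (u n \<ominus> l) \<le> dist2 (u n \<ominus> u (r j)) + dist2 (u (r j) \<ominus> l)"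
        using N1.dist_ideal_add N2.dist_ideal_add by simp_all
      then show ?thesis
        using N[OF n r[of k j]] k lim_j by (auto simp: j_def)
    qed
    then show "\<exists>M. \<forall>n\<in>{M..}. dist1 (u n \<ominus> l) \<le> e \<and> dist2 (u n \<ominus> l) \<le> e" by auto
  qed
  then have "D_converges AI U (I +> l)"
    by (simp add: D_converges_def U_eq diff_Q dnorm_Q Ball_def)
  then show ?thesis by (intro bexI[of _ "I +> l"]) auto
qed

lemma quotient_cstar_algebra: "bc_cstar_algebra AI"
proof
  fix Z c assume Z: "Z \<in> carrier AI"
  then obtain x where x: "x \<in> carrier A" "Z = I +> x" by (rule carrier_QE)
  note nonneg = N1.dist_ideal_nonneg[OF x(1)] N2.dist_ideal_nonneg[OF x(1)]
  show "dnorm AI Z \<in> hyp_nonneg"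
    using x nonneg by (simp add: dnorm_Q)
  show "dnorm AI Z = 0 \<longleftrightarrow> Z = \<zero>\<^bsub>AI\<^esub>"
    using x by (simp add: dnorm_Q hyp_zero zero_Q coset_eq_ideal_iff mem_ideal_iff_dist)
  show "dnorm AI (c \<odot>\<^bsub>AI\<^esub> Z) = hyp_modulus c * dnorm AI Z"
    using x by (simp add: dnorm_Q hyp_modulus_def hyp_mult N1.dist_ideal_smult N2.dist_ideal_smult)
  show "star AI Z \<in> carrier AI" "star AI (star AI Z) = Z"
    using x by (simp_all add: star_Q)
  show "dnorm AI (star AI Z \<otimes>\<^bsub>AI\<^esub> Z) = (dnorm AI Z)\<^sup>2"
    using x by (simp add: star_Q dnorm_Q hyp_power2 N1.dist_ideal_star_mult N2.dist_ideal_star_mult)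
  fix Y assume Y: "Y \<in> carrier AI"
  then obtain y where y: "y \<in> carrier A" "Y = I +> y" by (rule carrier_QE)
  show "dnorm AI (Z \<oplus>\<^bsub>AI\<^esub> Y) \<le>\<^sub>D dnorm AI Z + dnorm AI Y"
    using x y by (simp add: dnorm_Q hyp_add N1.dist_ideal_add N2.dist_ideal_add)
  show "dnorm AI (Z \<otimes>\<^bsub>AI\<^esub> Y) \<le>\<^sub>D dnorm AI Z * dnorm AI Y"
    using x y by (simp add: dnorm_Q hyp_mult N1.dist_ideal_mult N2.dist_ideal_mult)
  show "star AI (Z \<otimes>\<^bsub>AI\<^esub> Y) = star AI Y \<otimes>\<^bsub>AI\<^esub> star AI Z"
    using x y by (simp add: star_Q star_mult)
  show "star AI (c \<odot>\<^bsub>AI\<^esub> Z \<oplus>\<^bsub>AI\<^esub> Y) = bc_dagger3 c \<odot>\<^bsub>AI\<^esub> star AI Z \<oplus>\<^bsub>AI\<^esub> star AI Y"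
    using x y by (simp add: star_Q star_conj_linear)
qed (rule quotient_complete)

end

theorem theorem2p21:
  fixes A :: "'a bc_star_algebra" (structure) and I :: "'a set"
  assumes "bc_cstar_algebra A"
    and "bc_ideal I A"
    and "D_closed A I"
    and "I \<noteq> carrier A"
  shows "(\<forall>y\<in>I. star A y \<in> I) \<and>
    (\<forall>x\<in>carrier A. star (bc_quotient A I) (I +> x) = I +> star A x) \<and>
    bc_cstar_algebra (bc_quotient A I)"
proof -
  interpret cstar_closed_ideal A I
    using assms(1-3) by (intro cstar_closed_ideal.intro cstar_ideal.intro cstar_closed_ideal_axioms.intro)
  show ?thesis
    using star_ideal star_Q quotient_cstar_algebra by blast
qed

end
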